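(* Let $\lambda\vdash h$ be a partition and let $S,T$ be Young tableaux of the same shape $\lambda$ on the alphabet $\mathcal L=\{1,\dots,n\}$. Then in $\mathbf U(gl(n))$ the double Young-Capelli bitableau equals the following sum of Young-Capelli bitableaux: $$[\,\boxed{S\,|\,T}\,]=(-1)^{\binom h2}\sum_{\sigma}(-1)^{|\sigma|}\,[S\,|\,\boxed{T^{\sigma}}\,],$$ where the sum is extended over all row permutations $\sigma$ of $T$ (one permutation of the cells of each row), $T^\sigma$ is the tableau obtained from $T$ by permuting the elements of each row according to $\sigma$, and $(-1)^{|\sigma|}$ is the product of the signatures of the row permutations.
   Context: Virtual symbols. Let $\mathcal L=\{1,\dots,n\}$, and let $\mathcal A_0=\{\alpha_1,\dots,\alpha_{m_0}\}$, $\mathcal A_1=\{\beta_1,\dots,\beta_{m_1}\}$ be finite sets of auxiliary (virtual) symbols, with $m_0,m_1$ sufficiently large. Put $|a|=0\in\mathbb Z_2$ for $a\in\mathcal A_0$ and $|a|=1\in\mathbb Z_2$ for $a\in\mathcal A_1\cup\mathcal L$. Let $gl(m_0|m_1+n)$ be the complex Lie superalgebra with basis $e_{a,b}$, $a,b\in\mathcal A_0\cup\mathcal A_1\cup\mathcal L$, $|e_{a,b}|=|a|+|b|$, and superbracket $[e_{a,b},e_{c,d}]=\delta_{bc}e_{a,d}-(-1)^{(|a|+|b|)(|c|+|d|)}\delta_{ad}e_{c,b}$. Its enveloping superalgebra $\mathbf U(gl(m_0|m_1+n))$ contains $\mathbf U(gl(n))$ as the subalgebra generated by $e_{i,j}$,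 $i,j\in\mathcal L$. Devirtualization. A product $e_{a_m,b_m}\cdots e_{a_1,b_1}$ is irregular if there are $i\le m$ and a virtual symbol $\gamma\in\mathcal A_0\cup\mathcal A_1$ with $\#\{j\le i: b_j=\gamma\}>\#\{j<i: a_j=\gamma\}$. Let $\mathbf{Irr}$ be the left ideal of $\mathbf U(gl(m_0|m_1+n))$ generated by the irregular products. The sum $Virt=\mathbf U(gl(n))+\mathbf{Irr}$ is direct and is a subalgebra, in which $\mathbf{Irr}$ is a two-sided ideal; $\mathfrak p:Virt\to\mathbf U(gl(n))$ denotes the projection with kernel $\mathbf{Irr}$ (an algebra epimorphism). Tableaux. A Young tableau of shape $\lambda$ over an alphabet is any filling of the cells of the Ferrers diagram of $\lambda$ (rows of lengths $\lambda_1\ge\lambda_2\ge\cdots$). For tableaux $S,T$ of the same shape, $e_{S,T}$ is the product of the $e_{S(c),T(c)}$ over the cells $c$, read row by row from top to bottom, left to right in each row. $D^*_\lambda$ is the tableau of shape $\lambda$ whose $r$-th row is $\beta_1\beta_2\cdots\beta_{\lambda_r}$, and $C^*_\lambda$ the tableau of shape $\lambda$ whose $r$-th row is $\alpha_r\alpha_r\cdots\alpha_r$ (the $\alpha$'s and $\beta$'s being arbitrary distinct positive, resp. negative, virtual symbols). For tableaux $S,T$ of shape $\lambda$ over $\mathcal L$, the elements below lie in $Virt$ and their images do not depend on the choice of virtual symbols: Young-Capelli bitableau: $[S\,|\,\boxed{T}\,]=\mathfrak p\big(e_{S,C^*_\lambda}e_{C^*_\lambda,D^*_\lambda}e_{D^*_\lambda,T}\big)$;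 double Young-Capelli bitableau: $[\,\boxed{S\,|\,T}\,]=\mathfrak p\big(e_{S,C^*_\lambda}e_{C^*_\lambda,D^*_\lambda}e_{D^*_\lambda,C^*_\lambda}e_{C^*_\lambda,T}\big)$. *)

theory Defs
  imports Complex_Main "HOL-Library.Poly_Mapping" "HOL-Library.FuncSet"
    "HOL-Combinatorics.Permutations"
begin

section \<open>Symbols\<close>

text \<open>
  The alphabets are types: \<open>'p\<close> is the set of positive virtual symbols, \<open>'q\<close> the set of
  negative virtual symbols, and \<open>'n\<close> the set of proper symbols \<open>1, \<dots>, n\<close>. For finite types the
  enveloping superalgebra below is that of \<open>gl(m\<^sub>0 | m\<^sub>1 + n)\<close> where \<open>m\<^sub>0 = CARD('p)\<close>,
  \<open>m\<^sub>1 = CARD('q)\<close> and \<open>n = CARD('n)\<close>.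
\<close>

datatype ('p, 'q, 'n) symbol = Pos 'p | Neg 'q | Proper 'n

text \<open>Only the parity of this natural number matters: it is used in exponents of \<open>-1\<close>.\<close>

fun degree :: "('p, 'q, 'n) symbol \<Rightarrow> nat" where
  "degree (Pos _) = 0"
| "degree (Neg _) = 1"
| "degree (Proper _) = 1"

definition virtual :: "('p, 'q, 'n) symbol set" where
  "virtual = range Pos \<union> range Neg"


section \<open>The enveloping superalgebra\<close>

text \<open>
  Words form a monoid, written additively so that finitely supported functions on words,
  with the convolution product of \<^theory>\<open>HOL-Library.Poly_Mapping\<close>, are the free associative
  algebra, i.e. the tensor algebra of the vector space with the letters as basis. A letter
  \<open>(a, b)\<close> stands for the basis element \<open>e\<^bsub>a,b\<^esub>\<close>.
\<close>

datatype 'a word = Word (letters: "'a list")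

instantiation word :: (type) monoid_add
begin

definition zero_word :: "'a word" where
  "0 = Word []"

definition plus_word :: "'a word \<Rightarrow> 'a word \<Rightarrow> 'a word" where
  "v + w = Word (letters v @ letters w)"

instance
  by standard (simp_all add: zero_word_def plus_word_def)

end

type_synonym ('p, 'q, 'n) letter = "('p, 'q, 'n) symbol \<times> ('p, 'q, 'n) symbol"

type_synonym ('p, 'q, 'n) tensor_alg = "('p, 'q, 'n) letter word \<Rightarrow>\<^sub>0 complex"

definition gen :: "('p, 'q, 'n) letter \<Rightarrow> ('p, 'q, 'n) tensor_alg" where
  "gen x = Poly_Mapping.single (Word [x]) 1"

fun letter_degree :: "('p, 'q, 'n) letter \<Rightarrow> nat" where
  "letter_degree (a, b) = degree a + degree b"

fun superbracket ::
  "('p, 'q, 'n) letter \<Rightarrow> ('p, 'q, 'n) letter \<Rightarrow> ('p, 'q, 'n) tensor_alg" where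
  "superbracket (a, b) (c, d) =
     (if b = c then gen (a, d) else 0)
     - (- 1) ^ (letter_degree (a, b) * letter_degree (c, d)) * (if a = d then gen (c, b) else 0)"

definition left_ideal :: "'a::ring_1 set \<Rightarrow> bool" where
  "left_ideal I \<longleftrightarrow> 0 \<in> I \<and> (\<forall>x\<in>I. \<forall>y\<in>I. x + y \<in> I) \<and> (\<forall>r. \<forall>x\<in>I. r * x \<in> I)"

definition two_sided_ideal :: "'a::ring_1 set \<Rightarrow> bool" where
  "two_sided_ideal I \<longleftrightarrow> left_ideal I \<and> (\<forall>r. \<forall>x\<in>I. x * r \<in> I)"

definition env_ideal :: "('p, 'q, 'n) tensor_alg set" where
  "env_ideal = two_sided_ideal hull
     {gen x * gen y - (- 1) ^ (letter_degree x * letter_degree y) * (gen y * gen x)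
        - superbracket x y | x y. True}"

lemma two_sided_ideal_hull: "two_sided_ideal (two_sided_ideal hull S)"
  by (rule hull_in) (auto simp: two_sided_ideal_def left_ideal_def)

lemma env_ideal_two_sided: "two_sided_ideal env_ideal"
  unfolding env_ideal_def by (rule two_sided_ideal_hull)

lemma env_ideal_0: "0 \<in> env_ideal"
  and env_ideal_add: "x \<in> env_ideal \<Longrightarrow> y \<in> env_ideal \<Longrightarrow> x + y \<in> env_ideal"
  and env_ideal_mult_left: "x \<in> env_ideal \<Longrightarrow> r * x \<in> env_ideal"
  and env_ideal_mult_right: "x \<in> env_ideal \<Longrightarrow> x * r \<in> env_ideal"
  using env_ideal_two_sided unfolding two_sided_ideal_def left_ideal_def by blast+

lemma env_ideal_uminus: "x \<in> env_ideal \<Longrightarrow> - x \<in> env_ideal"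
  using env_ideal_mult_left[of x "- 1"] by simp

definition env_rel :: "('p, 'q, 'n) tensor_alg \<Rightarrow> ('p, 'q, 'n) tensor_alg \<Rightarrow> bool" where
  "env_rel x y \<longleftrightarrow> x - y \<in> env_ideal"

lemma env_rel_equivp: "equivp env_rel"
proof (rule equivpI)
  show "reflp env_rel"
    by (rule reflpI) (simp add: env_rel_def env_ideal_0)
  show "symp env_rel"
    by (rule sympI) (metis env_rel_def env_ideal_uminus minus_diff_eq)
  show "transp env_rel"
  proof (rule transpI)
    fix x y z :: "('p, 'q, 'n) tensor_alg"
    assume "env_rel x y" "env_rel y z"
    then have "(x - y) + (y - z) \<in> env_ideal"
      unfolding env_rel_def by (rule env_ideal_add)
    then show "env_rel x z"
      by (simp add: env_rel_def)
  qed
qed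

lemma lookup_single_word_zero [simp]:
  "Poly_Mapping.lookup (Poly_Mapping.single (Word (x # xs)) c) 0 = 0"
  by (simp add: lookup_single zero_word_def)

lemma lookup_mult_word_zero:
  fixes f g :: "'a word \<Rightarrow>\<^sub>0 'b::semiring_0"
  shows "Poly_Mapping.lookup (f * g) 0 = Poly_Mapping.lookup f 0 * Poly_Mapping.lookup g 0"
proof -
  have *: "(0::'a word) = l + q \<longleftrightarrow> l = 0 \<and> q = 0" for l q
    by (cases l; cases q) (auto simp: zero_word_def plus_word_def)
  have "(\<Sum>q. Poly_Mapping.lookup g q when (0::'a word) = l + q)
      = (Poly_Mapping.lookup g 0 when l = 0)" for l
  proof -
    have "(\<lambda>q. Poly_Mapping.lookup g q when (0::'a word) = l + q)
        = (\<lambda>q. (Poly_Mapping.lookup g q when l = 0) when q = 0)"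
      by (auto simp: fun_eq_iff when_def *)
    then show ?thesis by (simp only: Sum_any_when_equal)
  qed
  then have "Poly_Mapping.lookup (f * g) 0
      = (\<Sum>l. Poly_Mapping.lookup f l * Poly_Mapping.lookup g 0 when l = 0)"
    by (simp add: lookup_mult mult_when)
  then show ?thesis by simp
qed

lemma lookup_env_ideal_zero:
  fixes x :: "('p, 'q, 'n) tensor_alg"
  assumes "x \<in> env_ideal"
  shows "Poly_Mapping.lookup x 0 = 0"
proof -
  have br: "Poly_Mapping.lookup (superbracket x y) 0 = 0" for x y :: "('p, 'q, 'n) letter"
    by (cases x; cases y) (simp add: lookup_minus lookup_mult_word_zero gen_def)
  have "env_ideal \<subseteq> {x :: ('p, 'q, 'n) tensor_alg. Poly_Mapping.lookup x 0 = 0}"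
    unfolding env_ideal_def
  proof (rule hull_minimal)
    show "{gen x * gen y - (- 1) ^ (letter_degree x * letter_degree y) * (gen y * gen x)
        - superbracket x y | x y. True}
      \<subseteq> {x :: ('p, 'q, 'n) tensor_alg. Poly_Mapping.lookup x 0 = 0}"
      by (auto simp: lookup_minus lookup_mult_word_zero br simp del: superbracket.simps)
        (simp_all add: gen_def)
    show "two_sided_ideal {x :: ('p, 'q, 'n) tensor_alg. Poly_Mapping.lookup x 0 = 0}"
      by (simp add: two_sided_ideal_def left_ideal_def lookup_add lookup_mult_word_zero)
  qed
  with assms show ?thesis by blast
qed

quotient_type ('p, 'q, 'n) env = "('p, 'q, 'n) tensor_alg" / env_rel
  by (rule env_rel_equivp)

instantiation env :: (type, type, type) ring_1
begin

lift_definition zero_env :: "('p, 'q, 'n) env" is 0 .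

lift_definition one_env :: "('p, 'q, 'n) env" is 1 .

lift_definition plus_env :: "('p, 'q, 'n) env \<Rightarrow> ('p, 'q, 'n) env \<Rightarrow> ('p, 'q, 'n) env" is "(+)"
proof -
  fix x x' y y' :: "('p, 'q, 'n) tensor_alg"
  assume "env_rel x x'" "env_rel y y'"
  then have "(x - x') + (y - y') \<in> env_ideal"
    unfolding env_rel_def by (rule env_ideal_add)
  then show "env_rel (x + y) (x' + y')"
    by (simp add: env_rel_def algebra_simps)
qed

lift_definition uminus_env :: "('p, 'q, 'n) env \<Rightarrow> ('p, 'q, 'n) env" is uminus
proof -
  fix x x' :: "('p, 'q, 'n) tensor_alg"
  assume "env_rel x x'"
  then have "- (x - x') \<in> env_ideal"
    unfolding env_rel_def by (rule env_ideal_uminus)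
  then show "env_rel (- x) (- x')"
    by (simp add: env_rel_def algebra_simps)
qed

lift_definition minus_env :: "('p, 'q, 'n) env \<Rightarrow> ('p, 'q, 'n) env \<Rightarrow> ('p, 'q, 'n) env" is "(-)"
proof -
  fix x x' y y' :: "('p, 'q, 'n) tensor_alg"
  assume "env_rel x x'" "env_rel y y'"
  then have "(x - x') + - (y - y') \<in> env_ideal"
    unfolding env_rel_def by (intro env_ideal_add env_ideal_uminus)
  then show "env_rel (x - y) (x' - y')"
    by (simp add: env_rel_def algebra_simps)
qed

lift_definition times_env :: "('p, 'q, 'n) env \<Rightarrow> ('p, 'q, 'n) env \<Rightarrow> ('p, 'q, 'n) env" is "(*)"
proof -
  fix x x' y y' :: "('p, 'q, 'n) tensor_alg"
  assume "env_rel x x'" "env_rel y y'"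
  then have "(x - x') * y + x' * (y - y') \<in> env_ideal"
    unfolding env_rel_def by (intro env_ideal_add env_ideal_mult_left env_ideal_mult_right)
  then show "env_rel (x * y) (x' * y')"
    by (simp add: env_rel_def algebra_simps)
qed

instance
proof
  fix x y z :: "('p, 'q, 'n) env"
  show "x + y + z = x + (y + z)"
    by transfer (simp add: env_rel_def env_ideal_0 algebra_simps)
  show "x + y = y + x"
    by transfer (simp add: env_rel_def env_ideal_0 algebra_simps)
  show "0 + x = x"
    by transfer (simp add: env_rel_def env_ideal_0)
  show "- x + x = 0"
    by transfer (simp add: env_rel_def env_ideal_0)
  show "x - y = x + - y"
    by transfer (simp add: env_rel_def env_ideal_0)
  show "x * y * z = x * (y * z)"
    by transfer (simp add: env_rel_def env_ideal_0 mult.assoc)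
  show "1 * x = x"
    by transfer (simp add: env_rel_def env_ideal_0)
  show "x * 1 = x"
    by transfer (simp add: env_rel_def env_ideal_0)
  show "(x + y) * z = x * z + y * z"
    by transfer (simp add: env_rel_def env_ideal_0 algebra_simps)
  show "x * (y + z) = x * y + x * z"
    by transfer (simp add: env_rel_def env_ideal_0 algebra_simps)
  show "(0 :: ('p, 'q, 'n) env) \<noteq> 1"
    by transfer (auto simp: env_rel_def lookup_minus dest!: lookup_env_ideal_zero)
qed

end

text \<open>The complex scalars, as elements of the enveloping superalgebra.\<close>

lift_definition scalar :: "complex \<Rightarrow> ('p, 'q, 'n) env" is "Poly_Mapping.single 0" .

lift_definition e_elt :: "('p, 'q, 'n) symbol \<Rightarrow> ('p, 'q, 'n) symbol \<Rightarrow> ('p, 'q, 'n) env"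
  is "\<lambda>a b. gen (a, b)" .

definition e_prod :: "('p, 'q, 'n) letter list \<Rightarrow> ('p, 'q, 'n) env" where
  "e_prod w = prod_list (map (\<lambda>(a, b). e_elt a b) w)"

definition subalgebra :: "('p, 'q, 'n) env set \<Rightarrow> bool" where
  "subalgebra A \<longleftrightarrow> range scalar \<subseteq> A \<and> (\<forall>x\<in>A. \<forall>y\<in>A. x + y \<in> A \<and> x * y \<in> A)"

definition U_gl :: "('p, 'q, 'n) env set" where
  "U_gl = subalgebra hull {e_elt (Proper i) (Proper j) | i j. True}"


section \<open>Devirtualization\<close>

text \<open>
  Products are written as lists from left to right, so the first \<open>i\<close> factors of
  \<open>e\<^bsub>a\<^sub>m,b\<^sub>m\<^esub> \<cdots> e\<^bsub>a\<^sub>1,b\<^sub>1\<^esub>\<close>, counted from the right, are the suffix of length \<open>i\<close>; below this is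
  \<open>(a, b) # v\<close>, and \<open>v\<close> consists of the factors with index \<open>j < i\<close>.
\<close>

definition irregular :: "('p, 'q, 'n) letter list \<Rightarrow> bool" where
  "irregular w \<longleftrightarrow> (\<exists>u a b v. \<exists>\<gamma>\<in>virtual. w = u @ (a, b) # v \<and>
     count_list (map snd ((a, b) # v)) \<gamma> > count_list (map fst v) \<gamma>)"

definition Irr :: "('p, 'q, 'n) env set" where
  "Irr = left_ideal hull {e_prod w | w. irregular w}"

definition Virt :: "('p, 'q, 'n) env set" where
  "Virt = {u + r | u r. u \<in> U_gl \<and> r \<in> Irr}"

text \<open>
  The projection of \<^const>\<open>Virt\<close> onto \<^const>\<open>U_gl\<close> along \<^const>\<open>Irr\<close>; values outside \<^const>\<open>Virt\<close>
  are irrelevant. The description is unique because the sum is direct.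
\<close>

definition devirt :: "('p, 'q, 'n) env \<Rightarrow> ('p, 'q, 'n) env" where
  "devirt x = (THE u. u \<in> U_gl \<and> x - u \<in> Irr)"


section \<open>Tableaux and bitableaux\<close>

definition partition_of :: "nat list \<Rightarrow> nat \<Rightarrow> bool" where
  "partition_of lam h \<longleftrightarrow> sorted_wrt (\<ge>) lam \<and> 0 \<notin> set lam \<and> sum_list lam = h"

text \<open>A tableau is the list of its rows.\<close>

definition shape :: "'a list list \<Rightarrow> nat list" where
  "shape T = map length T"

definition e_tab ::
  "('p, 'q, 'n) symbol list list \<Rightarrow> ('p, 'q, 'n) symbol list list \<Rightarrow> ('p, 'q, 'n) env" where
  "e_tab S T = e_prod (zip (concat S) (concat T))"

definition proper_tab :: "'n list list \<Rightarrow> ('p, 'q, 'n) symbol list list" where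
  "proper_tab T = map (map Proper) T"

text \<open>
  Rows and columns are numbered from \<open>0\<close>. The functions \<open>\<alpha>\<close> and \<open>\<beta>\<close> choose the virtual symbols
  \<open>\<alpha>\<^sub>1, \<alpha>\<^sub>2, \<dots>\<close> and \<open>\<beta>\<^sub>1, \<beta>\<^sub>2, \<dots>\<close>; they must be injective on the row, resp. column, indices of the
  shape.
\<close>

definition C_tab :: "(nat \<Rightarrow> 'p) \<Rightarrow> nat list \<Rightarrow> ('p, 'q, 'n) symbol list list" where
  "C_tab \<alpha> lam = map (\<lambda>r. replicate (lam ! r) (Pos (\<alpha> r))) [0..<length lam]"

definition D_tab :: "(nat \<Rightarrow> 'q) \<Rightarrow> nat list \<Rightarrow> ('p, 'q, 'n) symbol list list" where
  "D_tab \<beta> lam = map (\<lambda>k. map (\<lambda>c. Neg (\<beta> c)) [0..<k]) lam"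

definition virtual_choice :: "(nat \<Rightarrow> 'p) \<Rightarrow> (nat \<Rightarrow> 'q) \<Rightarrow> nat list \<Rightarrow> bool" where
  "virtual_choice \<alpha> \<beta> lam \<longleftrightarrow> inj_on \<alpha> {..<length lam} \<and> (\<forall>k\<in>set lam. inj_on \<beta> {..<k})"

definition young_capelli ::
  "(nat \<Rightarrow> 'p) \<Rightarrow> (nat \<Rightarrow> 'q) \<Rightarrow> 'n list list \<Rightarrow> 'n list list \<Rightarrow> ('p, 'q, 'n) env" where
  "young_capelli \<alpha> \<beta> S T =
     (let C = C_tab \<alpha> (shape S); D = D_tab \<beta> (shape S)
      in devirt (e_tab (proper_tab S) C * e_tab C D * e_tab D (proper_tab T)))"

definition double_young_capelli ::
  "(nat \<Rightarrow> 'p) \<Rightarrow> (nat \<Rightarrow> 'q) \<Rightarrow> 'n list list \<Rightarrow> 'n list list \<Rightarrow> ('p, 'q, 'n) env" where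
  "double_young_capelli \<alpha> \<beta> S T =
     (let C = C_tab \<alpha> (shape S); D = D_tab \<beta> (shape S)
      in devirt (e_tab (proper_tab S) C * e_tab C D * e_tab D C * e_tab C (proper_tab T)))"

text \<open>One permutation of the cells of each row.\<close>

definition row_perms :: "nat list \<Rightarrow> (nat \<Rightarrow> nat \<Rightarrow> nat) set" where
  "row_perms lam = (\<Pi>\<^sub>E r\<in>{..<length lam}. {p. p permutes {..<lam ! r}})"

definition row_sign :: "nat list \<Rightarrow> (nat \<Rightarrow> nat \<Rightarrow> nat) \<Rightarrow> int" where
  "row_sign lam \<sigma> = (\<Prod>r<length lam. sign (\<sigma> r))"

definition permute_rows :: "(nat \<Rightarrow> nat \<Rightarrow> nat) \<Rightarrow> 'a list list \<Rightarrow> 'a list list" where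
  "permute_rows \<sigma> T = map (\<lambda>r. permute_list (\<sigma> r) (T ! r)) [0..<length T]"

end

theory Submission
  imports Defs
begin

text \<open>
  Modulo the left ideal \<^const>\<open>Irr\<close>, a factor \<open>e\<^bsub>d,c\<^esub>\<close> with \<open>c\<close> virtual acts on the factors to its right
  as a superderivation, because it vanishes on reaching the far right. Letting the factors of
  \<open>e\<^bsub>D,C\<^esub>\<close> act on \<open>e\<^bsub>C,T\<^esub>\<close>, each \<open>\<beta>\<close> of a row is paired with one entry of the same row of \<open>T\<close>; as
  the \<open>e\<^bsub>c,t\<^esub>\<close> are odd, this gives
  \<open>e\<^bsub>D,C\<^esub> e\<^bsub>C,T\<^esub> \<equiv> \<plusminus> \<Sum>\<^sub>\<sigma> (-1)\<^bsup>|\<sigma>|\<^esup> e\<^bsub>D,T\<^sup>\<sigma>\<^esub>\<close>,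
  and it remains to multiply by \<open>e\<^bsub>S,C\<^esub> e\<^bsub>C,D\<^esub>\<close> from the left.

  To pass to devirtualized images one needs \<open>U_gl \<inter> Irr = 0\<close>. The superalgebra acts on functions of
  words; irregular products annihilate the functions supported on words of proper symbols, by
  counting the occurrences of a virtual symbol, while \<^const>\<open>U_gl\<close> acts faithfully on these.
\<close>

section \<open>Computing in the enveloping superalgebra\<close>

text \<open>Two facts shape the proof. \<open>devirt\<close> is a definite description, so besides
  uniqueness each evaluation needs an explicit candidate in \<open>U_gl\<close>; and the two sides
  of the identity may use different virtual symbols. Balanced products settle both: a recursion on a
  word with abstract virtual names yields one element of \<open>U_gl\<close> that serves all
  injective renamings at once. Secondly, \<open>Irr\<close> is a left ideal, so a congruence may be
  multiplied from the left only; the rightmost factors must be rewritten first. Faithfulness follows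
  the pattern of Poincare-Birkhoff-Witt: modulo lower degree the monomials are indexed by multisets,
  and their top degree pairing with products F is diagonal with positive integer entries. The
  exponent \<open>h choose 2\<close> counts pairs of cells: pairs in one row come from polarizing
  that row, pairs in different rows from separating the odd factors of the rows.\<close>

lemma abs_env_eqI: "x - y \<in> env_ideal \<Longrightarrow> abs_env x = abs_env y"
  by (simp add: env.abs_eq_iff env_rel_def)

lemma abs_env_add: "abs_env (x + y) = abs_env x + abs_env y"
  and abs_env_mult: "abs_env (x * y) = abs_env x * abs_env y"
  and abs_env_diff: "abs_env (x - y) = abs_env x - abs_env y"
  and abs_env_0: "abs_env 0 = 0"
  and abs_env_1: "abs_env 1 = 1"
  by (simp_all add: plus_env.abs_eq times_env.abs_eq minus_env.abs_eq zero_env_def one_env_def)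

lemma abs_env_minus_one_power: "abs_env ((- 1) ^ k) = (- 1) ^ k"
  by (cases "even k") (simp_all add: abs_env_1 uminus_env.abs_eq [symmetric])

lemma e_elt_supercommute:
  "e_elt a b * e_elt c d =
     (- 1) ^ (letter_degree (a, b) * letter_degree (c, d)) * (e_elt c d * e_elt a b)
     + (if b = c then e_elt a d else 0)
     - (- 1) ^ (letter_degree (a, b) * letter_degree (c, d)) * (if a = d then e_elt c b else 0)"
proof -
  let ?s = "(- 1) ^ (letter_degree (a, b) * letter_degree (c, d)) :: ('a, 'b, 'c) tensor_alg"
  have "gen (a, b) * gen (c, d) - ?s * (gen (c, d) * gen (a, b)) - superbracket (a, b) (c, d)
      \<in> env_ideal"
    unfolding env_ideal_def by (rule hull_inc) blast
  then have "abs_env (gen (a, b) * gen (c, d) - ?s * (gen (c, d) * gen (a, b))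
      - superbracket (a, b) (c, d)) = abs_env 0"
    by (intro abs_env_eqI) simp
  then show ?thesis
    by (simp add: abs_env_add abs_env_mult abs_env_diff abs_env_0 abs_env_minus_one_power
        e_elt.abs_eq if_distrib [of abs_env] algebra_simps cong: if_cong del: letter_degree.simps)
qed

lemma poly_mapping_sum_singles:
  fixes p :: "'a \<Rightarrow>\<^sub>0 'b::comm_monoid_add"
  shows "p = (\<Sum>k\<in>Poly_Mapping.keys p. Poly_Mapping.single k (Poly_Mapping.lookup p k))"
  by (rule poly_mapping_eqI) (simp add: lookup_sum lookup_single when_def in_keys_iff sum.If_cases)

lemma scalar_add: "scalar (c + d) = scalar c + scalar d"
  and scalar_mult: "scalar (c * d) = scalar c * scalar d"
  and scalar_0 [simp]: "scalar 0 = 0"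
  and scalar_1 [simp]: "scalar 1 = 1"
  by (simp_all add: scalar.abs_eq abs_env_add [symmetric] abs_env_mult [symmetric] single_add
      mult_single abs_env_0 abs_env_1)

lemma scalar_commute: "scalar c * x = x * scalar c"
proof (induct x rule: env.abs_induct)
  case (1 p)
  have "Poly_Mapping.single 0 c * p = p * Poly_Mapping.single 0 c"
    by (subst (1 2) poly_mapping_sum_singles [of p])
      (simp add: sum_distrib_left sum_distrib_right mult_single mult.commute)
  then show ?case
    by (simp add: scalar.abs_eq abs_env_mult [symmetric])
qed

lemma mult_scalar_left: "x * (scalar c * y) = scalar c * (x * y)"
  by (metis mult.assoc scalar_commute)

lemma scalar_minus_one: "scalar (- 1) = - 1"
  using scalar_add [of 1 "- 1"] by (simp add: eq_neg_iff_add_eq_0 add.commute)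

lemma scalar_uminus: "scalar (- c) = - scalar c"
  using scalar_mult [of "- 1" c] by (simp add: scalar_minus_one)

lemma scalar_of_int: "scalar (of_int k) = of_int k"
proof -
  have "(scalar (of_nat n) :: ('a, 'b, 'c) env) = of_nat n" for n
    by (induct n) (simp_all add: scalar_add)
  then show ?thesis
    by (cases k) (simp_all add: scalar_uminus del: of_nat_Suc)
qed

text \<open>Supplies \<open>env.span\<close> for the degree filtration; the type \<open>env\<close>
  itself is only a ring, with the scalars embedded by \<open>scalar\<close>.\<close>

interpretation env: vector_space "\<lambda>c x. scalar c * x"
  by unfold_locales (simp_all add: algebra_simps scalar_add scalar_mult)

lemma e_prod_Nil [simp]: "e_prod [] = 1"
  and e_prod_Cons: "e_prod ((a, b) # w) = e_elt a b * e_prod w"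
  and e_prod_append: "e_prod (v @ w) = e_prod v * e_prod w"
  by (simp_all add: e_prod_def)

text \<open>The defining relation inside a product. All later rearrangements of products go through
  this form.\<close>

lemma e_prod_swap:
  "e_prod (u @ (a, b) # (c, d) # v) =
     (- 1) ^ (letter_degree (a, b) * letter_degree (c, d)) * e_prod (u @ (c, d) # (a, b) # v)
     + (if b = c then e_prod (u @ (a, d) # v) else 0)
     - (- 1) ^ (letter_degree (a, b) * letter_degree (c, d)) *
       (if a = d then e_prod (u @ (c, b) # v) else 0)"
proof -
  let ?s = "(- 1) ^ (letter_degree (a, b) * letter_degree (c, d)) :: ('a, 'b, 'c) env"
  have s: "x * (?s * y) = ?s * (x * y)" for x y
    by (cases "even (letter_degree (a, b) * letter_degree (c, d))") (simp_all del: letter_degree.simps)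
  have "e_prod (u @ (a, b) # (c, d) # v) = e_prod u * (e_elt a b * e_elt c d) * e_prod v"
    by (simp add: e_prod_append e_prod_Cons mult.assoc)
  also have "\<dots> = e_prod u * (?s * (e_elt c d * e_elt a b)
     + (if b = c then e_elt a d else 0) - ?s * (if a = d then e_elt c b else 0)) * e_prod v"
    by (subst e_elt_supercommute) (rule refl)
  also have "\<dots> = ?s * e_prod (u @ (c, d) # (a, b) # v)
     + (if b = c then e_prod (u @ (a, d) # v) else 0)
     - ?s * (if a = d then e_prod (u @ (c, b) # v) else 0)"
    by (simp add: e_prod_append e_prod_Cons algebra_simps s del: letter_degree.simps)
  finally show ?thesis .
qed

section \<open>Closure properties of \<open>U_gl\<close> and \<open>Irr\<close>\<close>

lemma subalgebra_U_gl: "subalgebra U_gl"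
  unfolding U_gl_def by (rule hull_in) (auto simp: subalgebra_def)

lemma U_gl_scalar: "scalar c \<in> U_gl"
  and U_gl_add: "x \<in> U_gl \<Longrightarrow> y \<in> U_gl \<Longrightarrow> x + y \<in> U_gl"
  and U_gl_mult: "x \<in> U_gl \<Longrightarrow> y \<in> U_gl \<Longrightarrow> x * y \<in> U_gl"
  using subalgebra_U_gl unfolding subalgebra_def by auto

lemma U_gl_0: "0 \<in> U_gl"
  using U_gl_scalar [of 0] by simp

lemma U_gl_of_int: "of_int k \<in> U_gl"
  using U_gl_scalar [of "of_int k"] by (simp add: scalar_of_int)

lemma U_gl_diff: "x \<in> U_gl \<Longrightarrow> y \<in> U_gl \<Longrightarrow> x - y \<in> U_gl"
  using U_gl_add [of x "of_int (- 1) * y"] U_gl_mult [OF U_gl_of_int, of y "- 1"] by simp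

lemma U_gl_sum: "(\<And>i. i \<in> A \<Longrightarrow> f i \<in> U_gl) \<Longrightarrow> sum f A \<in> U_gl"
  by (induct A rule: infinite_finite_induct) (auto intro: U_gl_0 U_gl_add)

lemma e_elt_in_U_gl: "e_elt (Proper i) (Proper j) \<in> U_gl"
  unfolding U_gl_def by (rule hull_inc) blast

lemma left_ideal_Irr: "left_ideal Irr"
  unfolding Irr_def by (rule hull_in) (auto simp: left_ideal_def)

lemma Irr_0: "0 \<in> Irr"
  and Irr_add: "x \<in> Irr \<Longrightarrow> y \<in> Irr \<Longrightarrow> x + y \<in> Irr"
  and Irr_mult: "x \<in> Irr \<Longrightarrow> r * x \<in> Irr"
  using left_ideal_Irr unfolding left_ideal_def by auto

lemma Irr_diff: "x \<in> Irr \<Longrightarrow> y \<in> Irr \<Longrightarrow> x - y \<in> Irr"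
  using Irr_add [of x "- 1 * y"] Irr_mult [of y "- 1"] by simp

lemma Irr_sum: "(\<And>i. i \<in> A \<Longrightarrow> f i \<in> Irr) \<Longrightarrow> sum f A \<in> Irr"
  by (induct A rule: infinite_finite_induct) (auto intro: Irr_0 Irr_add)

lemma irregular_in_Irr: "irregular w \<Longrightarrow> e_prod w \<in> Irr"
  unfolding Irr_def by (rule hull_inc) blast


section \<open>The action on functions of words\<close>

text \<open>
  The transpose of the action of the superalgebra by left superderivations on the free algebra
  over the variables \<open>(a|k)\<close>, \<open>k\<close> a proper symbol of parity \<open>0\<close>. Passing to functions on words
  makes every operator total without any finiteness condition.
\<close>

fun polarize ::
  "('p, 'q, 'n) letter \<Rightarrow> ((('p, 'q, 'n) symbol \<times> 'n) list \<Rightarrow> complex)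
    \<Rightarrow> (('p, 'q, 'n) symbol \<times> 'n) list \<Rightarrow> complex" where
  "polarize x f [] = 0"
| "polarize (a, b) f ((c, k) # w) = (if c = a then f ((b, k) # w) else 0)
     + (- 1) ^ (letter_degree (a, b) * degree c) * polarize (a, b) (\<lambda>v. f ((c, k) # v)) w"

lemma polarize_add: "polarize x (\<lambda>v. f v + g v) w = polarize x f w + polarize x g w"
proof (induct w arbitrary: f g)
  case (Cons y w)
  then show ?case by (cases x; cases y) (simp add: algebra_simps)
qed simp

lemma polarize_scale: "polarize x (\<lambda>v. c * f v) w = c * polarize x f w"
proof (induct w arbitrary: f)
  case (Cons y w)
  then show ?case by (cases x; cases y) (simp add: algebra_simps)
qed simp

lemma polarize_diff: "polarize x (\<lambda>v. f v - g v) w = polarize x f w - polarize x g w"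
  using polarize_add [of x f "\<lambda>v. (- 1) * g v"] unfolding polarize_scale by simp

lemma polarize_zero [simp]: "polarize x (\<lambda>v. 0) w = 0"
  using polarize_scale [of x 0 "\<lambda>v. 0"] by simp

lemma polarize_sum: "polarize x (\<lambda>v. \<Sum>i\<in>A. f i v) w = (\<Sum>i\<in>A. polarize x (f i) w)"
  by (induct A rule: infinite_finite_induct) (simp_all add: polarize_add)

lemma polarize_supercommute:
  fixes a b c d :: "('p, 'q, 'n) symbol"
  shows "polarize (a, b) (polarize (c, d) f) w =
     (- 1) ^ (letter_degree (a, b) * letter_degree (c, d)) * polarize (c, d) (polarize (a, b) f) w
     + (if b = c then polarize (a, d) f w else 0)
     - (- 1) ^ (letter_degree (a, b) * letter_degree (c, d)) *
       (if a = d then polarize (c, b) f w else 0)"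
proof (induct w arbitrary: f)
  case (Cons y w)
  obtain z k where y: "y = (z, k)" by fastforce
  define s where "s x y u = ((- 1) ^ (letter_degree (x, y) * degree u) :: complex)"
    for x y u :: "('p, 'q, 'n) symbol"
  define t where "t = ((- 1) ^ (letter_degree (a, b) * letter_degree (c, d)) :: complex)"
  have pol: "polarize (x, y) g ((u, l) # v) =
      (if u = x then g ((y, l) # v) else 0) + s x y u * polarize (x, y) (\<lambda>v. g ((u, l) # v)) v"
    for x y u :: "('p, 'q, 'n) symbol" and g l v
    by (simp add: s_def)
  \<comment> \<open>In \<open>s1\<close> and \<open>s2\<close> one operator changes the letter that
    the other has to pass; its parity changes by the degree of the first operator, whence the factor
    \<open>t\<close>. In \<open>s3\<close> and \<open>s4\<close> the degrees of two composable
    letters add up to that of their bracket term.\<close>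
  have s1: "s c d b = t * s c d a"
    unfolding s_def t_def power_add [symmetric] minus_one_power_iff by auto
  have s2: "s a b c = t * s a b d"
    unfolding s_def t_def power_add [symmetric] minus_one_power_iff by auto
  have s3: "s a b z * s c d z = s a d z" if "b = c"
    unfolding s_def power_add [symmetric] minus_one_power_iff using that by auto
  have s4: "s a b z * s c d z = s c b z" if "a = d"
    unfolding s_def power_add [symmetric] minus_one_power_iff using that by auto
  have IH: "polarize (a, b) (polarize (c, d) f) w = t * polarize (c, d) (polarize (a, b) f) w
     + (if b = c then polarize (a, d) f w else 0) - t * (if a = d then polarize (c, b) f w else 0)"
    for f
    using Cons by (simp add: t_def)
  \<comment> \<open>In \<open>X\<close> both operators act on the tail; in \<open>E\<close> and
    \<open>F\<close> only one does, the first letter having become \<open>g\<close>;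
    \<open>G\<close> and \<open>H\<close> are the bracket terms acting on the tail.\<close>
  define X where "X = polarize (c, d) (polarize (a, b) (\<lambda>v. f ((z, k) # v))) w"
  define E where "E g = polarize (a, b) (\<lambda>v. f ((g, k) # v)) w" for g
  define F where "F g = polarize (c, d) (\<lambda>v. f ((g, k) # v)) w" for g
  define G where "G = polarize (a, d) (\<lambda>v. f ((z, k) # v)) w"
  define H where "H = polarize (c, b) (\<lambda>v. f ((z, k) # v)) w"
  have EF: "polarize (a, b) (polarize (c, d) f) ((z, k) # w) =
      (if z = a then (if b = c then f ((d, k) # w) else 0) + s c d b * F b else 0)
      + s a b z * ((if z = c then E d else 0)
        + s c d z * (t * X + (if b = c then G else 0) - t * (if a = d then H else 0)))"
    unfolding pol by (simp add: polarize_add polarize_scale IH X_def E_def F_def G_def H_def)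
  have FE: "polarize (c, d) (polarize (a, b) f) ((z, k) # w) =
      (if z = c then (if d = a then f ((b, k) # w) else 0) + s a b d * E d else 0)
      + s c d z * ((if z = a then F b else 0) + s a b z * X)"
    unfolding pol by (simp add: polarize_add polarize_scale X_def E_def F_def)
  have "(if z = a then s c d b * F b else 0) = (if z = a then t * s c d z * F b else 0)"
    using s1 by simp
  moreover have "(if z = c then s a b z * E d else 0) = (if z = c then t * s a b d * E d else 0)"
    using s2 by simp
  moreover have "(if b = c then s a b z * s c d z * G else 0) = (if b = c then s a d z * G else 0)"
    using s3 by simp
  moreover have "(if a = d then s a b z * s c d z * H else 0) = (if a = d then s c b z * H else 0)"
    using s4 by simp
  ultimately show ?case
    unfolding y EF FE t_def [symmetric] pol [of a d] pol [of c b] G_def [symmetric] H_def [symmetric]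
    by (auto simp: algebra_simps split: if_splits)
qed simp

definition word_act ::
  "('p, 'q, 'n) letter list \<Rightarrow> ((('p, 'q, 'n) symbol \<times> 'n) list \<Rightarrow> complex)
    \<Rightarrow> (('p, 'q, 'n) symbol \<times> 'n) list \<Rightarrow> complex" where
  "word_act w f = foldr polarize w f"

lemma word_act_Nil [simp]: "word_act [] f = f"
  and word_act_Cons [simp]: "word_act (x # w) f = polarize x (word_act w f)"
  and word_act_append: "word_act (v @ w) f = word_act v (word_act w f)"
  by (simp_all add: word_act_def)

lemma word_act_scale: "word_act u (\<lambda>v. c * f v) w = c * word_act u f w"
proof (induct u arbitrary: w)
  case (Cons x u)
  then have "word_act u (\<lambda>v. c * f v) = (\<lambda>w. c * word_act u f w)" by blast
  then show ?case by (simp add: polarize_scale)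
qed simp

lemma word_act_sum: "word_act u (\<lambda>v. \<Sum>i\<in>A. f i v) w = (\<Sum>i\<in>A. word_act u (f i) w)"
proof (induct u arbitrary: w)
  case (Cons x u)
  then have "word_act u (\<lambda>v. \<Sum>i\<in>A. f i v) = (\<lambda>w. \<Sum>i\<in>A. word_act u (f i) w)" by blast
  then show ?case by (simp add: polarize_sum)
qed simp

section \<open>Extension of the action to the tensor algebra and its quotient\<close>

definition tensor_act ::
  "('p, 'q, 'n) tensor_alg \<Rightarrow> ((('p, 'q, 'n) symbol \<times> 'n) list \<Rightarrow> complex)
    \<Rightarrow> (('p, 'q, 'n) symbol \<times> 'n) list \<Rightarrow> complex" where
  "tensor_act p f w =
     (\<Sum>v\<in>Poly_Mapping.keys p. Poly_Mapping.lookup p v * word_act (letters v) f w)"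

lemma tensor_act_superset:
  assumes "finite K" "Poly_Mapping.keys p \<subseteq> K"
  shows "tensor_act p f w = (\<Sum>v\<in>K. Poly_Mapping.lookup p v * word_act (letters v) f w)"
  unfolding tensor_act_def using assms
  by (intro sum.mono_neutral_left) (auto simp: in_keys_iff)

lemma tensor_act_add: "tensor_act (p + q) f w = tensor_act p f w + tensor_act q f w"
proof -
  let ?K = "Poly_Mapping.keys p \<union> Poly_Mapping.keys q"
  have K: "finite ?K" "Poly_Mapping.keys (p + q) \<subseteq> ?K" "Poly_Mapping.keys p \<subseteq> ?K"
    "Poly_Mapping.keys q \<subseteq> ?K"
    by (auto dest: subsetD [OF keys_add])
  show ?thesis
    unfolding tensor_act_superset [OF K(1) K(2)] tensor_act_superset [OF K(1) K(3)]
      tensor_act_superset [OF K(1) K(4)]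
    by (simp add: lookup_add algebra_simps sum.distrib)
qed

lemma tensor_act_single:
  "tensor_act (Poly_Mapping.single v c) f w = c * word_act (letters v) f w"
  by (simp add: tensor_act_def)

lemma tensor_act_0: "tensor_act 0 f w = 0"
  by (simp add: tensor_act_def)

lemma tensor_act_sum: "tensor_act (\<Sum>i\<in>A. p i) f w = (\<Sum>i\<in>A. tensor_act (p i) f w)"
  by (induct A rule: infinite_finite_induct) (simp_all add: tensor_act_add tensor_act_0)

lemma word_act_zero_fun [simp]: "word_act u (\<lambda>v. 0) w = 0"
  using word_act_scale [of u 0 "\<lambda>v. 0"] by simp

lemma tensor_act_zero_fun: "tensor_act p (\<lambda>v. 0) w = 0"
  by (simp add: tensor_act_def)

lemma tensor_act_mult: "tensor_act (p * q) f w = tensor_act p (tensor_act q f) w"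
proof -
  have "p * q = (\<Sum>v\<in>Poly_Mapping.keys p. Poly_Mapping.single v (Poly_Mapping.lookup p v)) *
      (\<Sum>u\<in>Poly_Mapping.keys q. Poly_Mapping.single u (Poly_Mapping.lookup q u))"
    by (simp only: poly_mapping_sum_singles [symmetric])
  also have "\<dots> = (\<Sum>v\<in>Poly_Mapping.keys p. \<Sum>u\<in>Poly_Mapping.keys q.
      Poly_Mapping.single (v + u) (Poly_Mapping.lookup p v * Poly_Mapping.lookup q u))"
    by (simp only: sum_product mult_single)
  finally have "tensor_act (p * q) f w =
      (\<Sum>v\<in>Poly_Mapping.keys p. \<Sum>u\<in>Poly_Mapping.keys q.
         (Poly_Mapping.lookup p v * Poly_Mapping.lookup q u) *
         word_act (letters v) (word_act (letters u) f) w)"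
    by (simp only: tensor_act_sum tensor_act_single plus_word_def word.sel word_act_append)
  also have "\<dots> = tensor_act p (tensor_act q f) w"
    unfolding tensor_act_def [of p] tensor_act_def [of q, abs_def]
    by (simp add: word_act_sum word_act_scale sum_distrib_left mult.assoc)
  finally show ?thesis .
qed

lemma tensor_act_gen: "tensor_act (gen x) f w = polarize x f w"
  by (simp add: gen_def tensor_act_single)

lemma tensor_act_diff: "tensor_act (p - q) f w = tensor_act p f w - tensor_act q f w"
  using tensor_act_add [of "p - q" q f w] by simp

lemma tensor_act_minus_one_power:
  "tensor_act ((- 1) ^ k * p) f w = (- 1) ^ k * tensor_act p f w"
  using tensor_act_diff [of 0 p f w] by (cases "even k") (simp_all add: tensor_act_0)

text \<open>The elements that kill every function form a two-sided ideal, and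
  \<open>polarize_supercommute\<close> puts the defining relations into it. Closure under right
  multiplication is the reason why \<open>V\<close> quantifies over \<open>f\<close>.\<close>

lemma tensor_act_env_ideal:
  fixes p :: "('p, 'q, 'n) tensor_alg"
  assumes "p \<in> env_ideal"
  shows "tensor_act p f = (\<lambda>w. 0)"
proof -
  define V where "V p \<longleftrightarrow> (\<forall>f. tensor_act p f = (\<lambda>w. 0))" for p :: "('p, 'q, 'n) tensor_alg"
  have mult: "tensor_act (p * q) f = tensor_act p (tensor_act q f)"
    for p q :: "('p, 'q, 'n) tensor_alg" and f
    by (simp add: fun_eq_iff tensor_act_mult)
  have V: "V 0" "V x \<Longrightarrow> V y \<Longrightarrow> V (x + y)" for x y
    by (simp_all add: V_def tensor_act_0 tensor_act_add fun_eq_iff)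
  have zero_fun: "tensor_act r (\<lambda>w. 0) = (\<lambda>w. 0)" for r :: "('p, 'q, 'n) tensor_alg"
    by (simp add: fun_eq_iff tensor_act_zero_fun)
  have V_mult: "V (r * x)" "V (x * r)" if "V x" for x r
    using that by (simp_all add: V_def mult zero_fun)
  have "env_ideal \<subseteq> Collect V"
    unfolding env_ideal_def
  proof (rule hull_minimal)
    show "two_sided_ideal (Collect V)"
      by (auto simp: two_sided_ideal_def left_ideal_def intro: V V_mult)
    have g: "tensor_act (gen x * gen y) f w = polarize x (polarize y f) w" for x y f w
      by (simp add: tensor_act_mult tensor_act_gen [abs_def])
    have rel: "tensor_act (gen x * gen y - (- 1) ^ (letter_degree x * letter_degree y) * (gen y * gen x)
        - superbracket x y) f w = 0" for x y f and w :: "(('p, 'q, 'n) symbol \<times> 'n) list"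
    proof (cases x; cases y)
      fix a b c d
      assume "x = (a, b)" "y = (c, d)"
      then show ?thesis
        using polarize_supercommute [of a b c d f w]
        by (simp add: tensor_act_diff tensor_act_minus_one_power g tensor_act_gen
            if_distrib [of "\<lambda>p. tensor_act p f w"] tensor_act_0
            del: letter_degree.simps cong: if_cong)
    qed
    show "{gen x * gen y - (- 1) ^ (letter_degree x * letter_degree y) * (gen y * gen x)
        - superbracket x y | x y. True} \<subseteq> Collect V"
      unfolding V_def using rel
        by (intro subsetI) (elim CollectE exE, simp only: mem_Collect_eq fun_eq_iff simp_thms)
  qed
  then show ?thesis using assms by (auto simp: V_def)
qed

lift_definition env_act ::
  "('p, 'q, 'n) env \<Rightarrow> ((('p, 'q, 'n) symbol \<times> 'n) list \<Rightarrow> complex)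
    \<Rightarrow> (('p, 'q, 'n) symbol \<times> 'n) list \<Rightarrow> complex" is tensor_act
proof -
  fix p q :: "('p, 'q, 'n) tensor_alg"
  assume "env_rel p q"
  then have "tensor_act (p - q) f w = 0" for f and w :: "(('p, 'q, 'n) symbol \<times> 'n) list"
    by (simp add: env_rel_def tensor_act_env_ideal)
  then show "tensor_act p = tensor_act q"
    by (simp add: tensor_act_diff fun_eq_iff)
qed

lemma env_act_add: "env_act (x + y) f w = env_act x f w + env_act y f w"
  by transfer (rule tensor_act_add)

lemma env_act_0 [simp]: "env_act 0 f w = 0"
  by transfer (rule tensor_act_0)

lemma env_act_mult: "env_act (x * y) f = env_act x (env_act y f)"
  by transfer (simp add: fun_eq_iff tensor_act_mult)

lemma env_act_zero_fun: "env_act x (\<lambda>v. 0) = (\<lambda>w. 0)"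
  by transfer (simp add: fun_eq_iff tensor_act_zero_fun)

lemma env_act_scalar [simp]: "env_act (scalar c) f w = c * f w"
  by transfer (simp add: tensor_act_single zero_word_def)

lemma env_act_e_elt: "env_act (e_elt a b) f = polarize (a, b) f"
  by transfer (simp add: fun_eq_iff tensor_act_gen)

lemma env_act_e_prod: "env_act (e_prod w) f = word_act w f"
proof (induct w)
  case Nil
  show ?case using env_act_scalar [of 1 f] by (simp add: fun_eq_iff)
next
  case (Cons x w)
  then show ?case by (cases x) (simp add: e_prod_Cons env_act_mult env_act_e_elt)
qed

section \<open>Supports, and the vanishing of irregular products\<close>

lemma polarize_supp:
  assumes "polarize (a, b) f w \<noteq> 0"
  shows "\<exists>u k v. w = u @ (a, k) # v \<and> f (u @ (b, k) # v) \<noteq> 0"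
  using assms
proof (induct w arbitrary: f)
  case (Cons y w)
  obtain c k where y: "y = (c, k)" by fastforce
  show ?case
  proof (cases "c = a \<and> f ((b, k) # w) \<noteq> 0")
    case True
    then show ?thesis unfolding y by (intro exI [of _ "[]"]) auto
  next
    case False
    then have "polarize (a, b) (\<lambda>v. f ((c, k) # v)) w \<noteq> 0"
      using Cons.prems unfolding y by (auto split: if_splits)
    then obtain u l v where "w = u @ (a, l) # v" "f ((c, k) # u @ (b, l) # v) \<noteq> 0"
      using Cons.hyps by blast
    then show ?thesis unfolding y by (intro exI [of _ "(c, k) # u"]) auto
  qed
qed simp

text \<open>Evaluated at a word, each factor \<open>(a, b)\<close> trades one occurrence of
  \<open>a\<close> for one of \<open>b\<close>, and the word that finally reaches \<open>f\<close>
  is free of \<open>\<gamma>\<close>. This conservation law determines the number of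
  \<open>\<gamma>\<close> in \<open>w\<close>.\<close>

lemma word_act_supp:
  assumes "word_act u f w \<noteq> 0"
    and "\<And>v. f v \<noteq> 0 \<Longrightarrow> count_list (map fst v) \<gamma> = 0"
  shows "count_list (map fst w) \<gamma> + count_list (map snd u) \<gamma> = count_list (map fst u) \<gamma>"
  using assms(1)
proof (induct u arbitrary: w)
  case Nil
  then show ?case using assms(2) by simp
next
  case (Cons x u)
  obtain a b where x: "x = (a, b)" by fastforce
  with Cons.prems obtain v1 k v2 where w: "w = v1 @ (a, k) # v2"
    and "word_act u f (v1 @ (b, k) # v2) \<noteq> 0"
    using polarize_supp [of a b "word_act u f" w] by auto
  from Cons.hyps [OF this(2)] show ?case
    by (auto simp: w x)
qed

definition proper_supported ::
  "((('p, 'q, 'n) symbol \<times> 'n) list \<Rightarrow> complex) \<Rightarrow> bool" where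
  "proper_supported f \<longleftrightarrow> (\<forall>w. f w \<noteq> 0 \<longrightarrow> fst ` set w \<inter> virtual = {})"

text \<open>In the offending suffix, \<open>v\<close> acts at a word that contains \<open>b\<close>,
  whereas \<open>word_act_supp\<close> leaves room for fewer \<open>\<gamma>\<close> than this
  \<open>b\<close> and the other letters contribute.\<close>

lemma irregular_act:
  assumes "irregular w" "proper_supported f"
  shows "word_act w f = (\<lambda>v. 0)"
proof -
  obtain u a b v \<gamma> where \<gamma>: "\<gamma> \<in> virtual" and w: "w = u @ (a, b) # v"
    and c: "count_list (map snd ((a, b) # v)) \<gamma> > count_list (map fst v) \<gamma>"
    using assms(1) unfolding irregular_def by blast
  have f: "count_list (map fst v) \<gamma> = 0" if "f v \<noteq> 0" for v
    using assms(2) \<gamma> that by (auto simp: proper_supported_def count_list_0_iff)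
  \<comment> \<open>The factor \<open>(a, b)\<close> is peeled off before counting: irregularity
    does not count \<open>a\<close>, so counting for the whole suffix would give no contradiction
    when \<open>a = \<gamma>\<close>.\<close>
  have "word_act ((a, b) # v) f z = 0" for z
  proof (rule ccontr)
    assume "word_act ((a, b) # v) f z \<noteq> 0"
    then obtain v1 k v2 where "word_act v f (v1 @ (b, k) # v2) \<noteq> 0"
      using polarize_supp [of a b "word_act v f" z] by auto
    from word_act_supp [OF this f] c show False
      by (simp split: if_splits)
  qed
  then have "word_act ((a, b) # v) f = (\<lambda>z. 0)" by blast
  then show ?thesis
    using env_act_zero_fun [of "e_prod u"] unfolding w word_act_append env_act_e_prod by simp
qed

text \<open>The annihilator of the fixed function \<open>f\<close> is a left ideal, and
  \<open>Irr\<close> is the least one containing the irregular products.\<close>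

lemma Irr_act:
  fixes x :: "('p, 'q, 'n) env"
  assumes "x \<in> Irr" "proper_supported f"
  shows "env_act x f = (\<lambda>w. 0)"
proof -
  define V where "V x \<longleftrightarrow> env_act x f = (\<lambda>w. 0)" for x :: "('p, 'q, 'n) env"
  have V: "V 0" "V x \<Longrightarrow> V y \<Longrightarrow> V (x + y)" for x y
    by (simp_all add: V_def env_act_add fun_eq_iff)
  have V_mult: "V (r * x)" if "V x" for x r
    using that by (simp add: V_def env_act_mult env_act_zero_fun)
  have "Irr \<subseteq> Collect V"
    unfolding Irr_def
  proof (rule hull_minimal)
    show "left_ideal (Collect V)"
      by (auto simp: left_ideal_def intro: V V_mult)
    show "{e_prod w | w. irregular w} \<subseteq> Collect V"
      using assms(2) by (auto simp: V_def env_act_e_prod irregular_act)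
  qed
  then show ?thesis using assms(1) by (auto simp: V_def)
qed

section \<open>Faithfulness on the proper part\<close>

text \<open>
  The series \<open>counit\<close> sends \<open>(c|k)\<close> to \<open>\<delta>\<^bsub>c,k\<^esub>\<close> multiplicatively, and \<open>diff_eval f F\<close> evaluates
  \<open>f\<close> at the product of the elements \<open>(i|k) - \<delta>\<^bsub>i,k\<^esub>\<close>, \<open>(i, k)\<close> in \<open>F\<close>, of the kernel of \<open>counit\<close>.
  In effect, elements of the enveloping algebra become distributions supported at the identity
  matrix, and the order of vanishing there recovers the top degree part.
\<close>

fun counit :: "(('p, 'q, 'n) symbol \<times> 'n) list \<Rightarrow> complex" where
  "counit [] = 1"
| "counit ((c, k) # w) = (if c = Proper k then counit w else 0)"

fun diff_eval ::
  "((('p, 'q, 'n) symbol \<times> 'n) list \<Rightarrow> complex) \<Rightarrow> ('n \<times> 'n) list \<Rightarrow> complex" where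
  "diff_eval f [] = f []"
| "diff_eval f ((i, k) # F) =
     diff_eval (\<lambda>v. f ((Proper i, k) # v) - (if i = k then f v else 0)) F"

lemma diff_eval_add: "diff_eval (\<lambda>v. f v + g v) F = diff_eval f F + diff_eval g F"
proof (induct F arbitrary: f g)
  case (Cons x F)
  obtain i k where x: "x = (i, k)" by fastforce
  show ?case
    unfolding x diff_eval.simps Cons [symmetric]
    by (rule arg_cong [of _ _ "\<lambda>f. diff_eval f F"]) auto
qed simp

lemma diff_eval_scale: "diff_eval (\<lambda>v. c * f v) F = c * diff_eval f F"
proof (induct F arbitrary: f)
  case (Cons x F)
  obtain i k where x: "x = (i, k)" by fastforce
  show ?case
    unfolding x diff_eval.simps Cons [symmetric]
    by (rule arg_cong [of _ _ "\<lambda>f. diff_eval f F"]) (auto simp: algebra_simps)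
qed simp

lemma diff_eval_zero [simp]: "diff_eval (\<lambda>v. 0) F = 0"
  using diff_eval_scale [of 0 "\<lambda>v. 0"] by simp

text \<open>Leibniz rule on the first factor: there the derivation yields \<open>(j|k)\<close> if
  \<open>c = i\<close>, and \<open>(j|k)\<close> is the kernel element for \<open>(j, k)\<close>
  plus the constant \<open>of_bool (j = k)\<close>. The operator is even, so no sign
  appears.\<close>

lemma diff_eval_polarize_Cons:
  "diff_eval (polarize (Proper i, Proper j) f) ((c, k) # F) =
     (if c = i then diff_eval f ((j, k) # F) + (if j = k then diff_eval f F else 0) else 0)
     + diff_eval (polarize (Proper i, Proper j)
         (\<lambda>v. f ((Proper c, k) # v) - (if c = k then f v else 0))) F"
proof -
  let ?p = "polarize (Proper i, Proper j)"
  have *: "diff_eval f ((j, k) # F) + (if j = k then diff_eval f F else 0)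
      = diff_eval (\<lambda>v. f ((Proper j, k) # v)) F"
    by (cases "j = k") (simp_all add: diff_eval_add [symmetric])
  have "diff_eval (?p f) ((c, k) # F) =
      diff_eval (\<lambda>v. (if c = i then f ((Proper j, k) # v) else 0)
        + ?p (\<lambda>v. f ((Proper c, k) # v) - (if c = k then f v else 0)) v) F"
    unfolding diff_eval.simps
    by (rule arg_cong [of _ _ "\<lambda>f. diff_eval f F"]) (auto simp: polarize_diff)
  then show ?thesis
    unfolding * diff_eval_add by simp
qed

text \<open>Order less than \<open>m\<close> as a distribution at the identity matrix.\<close>

definition vanishes :: "nat \<Rightarrow> ((('p, 'q, 'n) symbol \<times> 'n) list \<Rightarrow> complex) \<Rightarrow> bool" where
  "vanishes m f \<longleftrightarrow> (\<forall>F. m \<le> length F \<longrightarrow> diff_eval f F = 0)"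

lemma vanishes_shift:
  fixes f :: "(('p, 'q, 'n) symbol \<times> 'n) list \<Rightarrow> complex"
  assumes "vanishes m f"
  shows "vanishes (m - 1) (\<lambda>v. f ((Proper c, k) # v) - (if c = k then f v else 0))"
  unfolding vanishes_def
proof (intro allI impI)
  fix F :: "('n \<times> 'n) list"
  assume "m - 1 \<le> length F"
  then have "diff_eval f ((c, k) # F) = 0"
    using assms unfolding vanishes_def by (intro assms [unfolded vanishes_def, rule_format]) simp
  then show "diff_eval (\<lambda>v. f ((Proper c, k) # v) - (if c = k then f v else 0)) F = 0"
    by simp
qed

lemma vanishes_polarize:
  assumes "vanishes m f"
  shows "vanishes (Suc m) (polarize (Proper i, Proper j) f)"
proof -
  \<comment> \<open>The alternative \<open>F = []\<close>, where \<open>polarize\<close> gives 0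
    anyway, keeps the induction alive at \<open>m = 0\<close>, where \<open>m - 1\<close> is
    truncated.\<close>
  have "diff_eval (polarize (Proper i, Proper j) f) F = 0" if "F = [] \<or> Suc m \<le> length F" for F
    using assms that
  proof (induct F arbitrary: f m)
    case (Cons x F)
    obtain c k where x: "x = (c, k)" by fastforce
    have F: "m \<le> length F" using Cons.prems(2) by simp
    have "diff_eval f ((j, k) # F) = 0" "diff_eval f F = 0"
      using Cons.prems(1) F unfolding vanishes_def by (simp_all del: diff_eval.simps)
    moreover have "F = [] \<or> Suc (m - 1) \<le> length F"
      using F by (cases F) auto
    ultimately show ?case
      unfolding x diff_eval_polarize_Cons
      by (simp add: Cons.hyps [OF vanishes_shift [OF Cons.prems(1)]] del: diff_eval.simps)
  qed simp
  then show ?thesis by (simp add: vanishes_def)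
qed

text \<open>In top degree the terms that keep all \<open>m\<close> factors vanish, and only the
  constants survive. On leading parts the operator is thus the partial derivative in the variable
  \<open>(i|j)\<close>.\<close>

lemma diff_eval_polarize_top:
  assumes "vanishes m f" "length F = m"
  shows "diff_eval (polarize (Proper i, Proper j) f) F =
    (\<Sum>l<length F. if F ! l = (i, j) then diff_eval f (take l F @ drop (Suc l) F) else 0)"
  using assms
proof (induct F arbitrary: f m)
  case (Cons x F)
  obtain c k where x: "x = (c, k)" by fastforce
  let ?g = "\<lambda>v. f ((Proper c, k) # v) - (if c = k then f v else 0)"
  have "diff_eval f ((j, k) # F) = 0"
    using Cons.prems unfolding vanishes_def by (simp del: diff_eval.simps)
  moreover have "diff_eval (polarize (Proper i, Proper j) ?g) F =
      (\<Sum>l<length F. if F ! l = (i, j) then diff_eval ?g (take l F @ drop (Suc l) F) else 0)"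
    using Cons.prems(2) by (intro Cons.hyps [OF vanishes_shift [OF Cons.prems(1)]]) auto
  moreover have "(\<Sum>l<length (x # F). if (x # F) ! l = (i, j)
        then diff_eval f (take l (x # F) @ drop (Suc l) (x # F)) else 0) =
      (if x = (i, j) then diff_eval f F else 0) +
      (\<Sum>l<length F. if F ! l = (i, j) then diff_eval ?g (take l F @ drop (Suc l) F) else 0)"
    by (simp add: x sum.lessThan_Suc_shift del: sum.lessThan_Suc cong: if_cong)
  ultimately show ?case
    unfolding x diff_eval_polarize_Cons by auto
qed simp

definition proper_word :: "('n \<times> 'n) list \<Rightarrow> ('p, 'q, 'n) letter list" where
  "proper_word w = map (\<lambda>(i, j). (Proper i, Proper j)) w"

lemma proper_word_simps [simp]:
  "proper_word [] = []"
  "proper_word ((i, j) # w) = (Proper i, Proper j) # proper_word w"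
  "proper_word (v @ w) = proper_word v @ proper_word w"
  by (simp_all add: proper_word_def)

lemma vanishes_counit: "vanishes 1 (counit :: (('p, 'q, 'n) symbol \<times> 'n) list \<Rightarrow> complex)"
  unfolding vanishes_def
proof (intro allI impI)
  fix F :: "('n \<times> 'n) list"
  assume "1 \<le> length F"
  then obtain i k F' where F: "F = (i, k) # F'" by (cases F) auto
  have "(\<lambda>v. (counit :: (('p, 'q, 'n) symbol \<times> 'n) list \<Rightarrow> complex) ((Proper i, k) # v)
      - (if i = k then counit v else 0)) = (\<lambda>v. 0)"
    by auto
  then show "diff_eval (counit :: (('p, 'q, 'n) symbol \<times> 'n) list \<Rightarrow> complex) F = 0"
    unfolding F diff_eval.simps by simp
qed

lemma vanishes_word_act: "vanishes (Suc (length w)) (word_act (proper_word w) counit)"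
proof (induct w)
  case Nil
  show ?case using vanishes_counit by simp
next
  case (Cons x w)
  then show ?case by (cases x) (simp add: vanishes_polarize)
qed

lemma mset_remove_nth: "l < length F \<Longrightarrow> mset F = add_mset (F ! l) (mset (take l F @ drop (Suc l) F))"
  by (subst id_take_nth_drop [of l F]) auto

text \<open>The value counts the ways to delete the positions of \<open>F\<close> one by one so that
  the deleted pairs spell \<open>w\<close>. Being a sum of naturals it cannot cancel, so it is
  nonzero as soon as one way exists.\<close>

lemma diff_eval_word_act_top:
  assumes "length w = length F"
  shows "\<exists>n. diff_eval (word_act (proper_word w) (counit :: (('p, 'q, 'n) symbol \<times> 'n) list \<Rightarrow> complex)) F
      = of_nat n \<and> (n \<noteq> 0 \<longleftrightarrow> mset w = mset F)"
  using assms
proof (induct w arbitrary: F)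
  case Nil
  then show ?case by (intro exI [of _ 1]) simp
next
  case (Cons x w)
  obtain i j where x: "x = (i, j)" by fastforce
  let ?f = "word_act (proper_word w) (counit :: (('p, 'q, 'n) symbol \<times> 'n) list \<Rightarrow> complex)"
  let ?F = "\<lambda>l. take l F @ drop (Suc l) F"
  have "\<forall>l\<in>{..<length F}. \<exists>n. diff_eval ?f (?F l) = of_nat n \<and> (n \<noteq> 0 \<longleftrightarrow> mset w = mset (?F l))"
    using Cons.prems by (intro ballI Cons.hyps) auto
  then obtain n where n: "diff_eval ?f (?F l) = of_nat (n l)"
    "n l \<noteq> 0 \<longleftrightarrow> mset w = mset (?F l)" if "l < length F" for l
    by (metis lessThan_iff)
  let ?n = "\<Sum>l<length F. if F ! l = x then n l else 0"
  have "diff_eval (word_act (proper_word (x # w)) (counit :: (('p, 'q, 'n) symbol \<times> 'n) list \<Rightarrow> complex)) F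
      = (\<Sum>l<length F. if F ! l = x then diff_eval ?f (?F l) else 0)"
    using diff_eval_polarize_top [OF vanishes_word_act, of F w i j] Cons.prems
    by (simp add: x del: sum.lessThan_Suc)
  also have "\<dots> = of_nat ?n"
    by (simp add: n if_distrib [of of_nat] cong: if_cong)
  finally have *: "diff_eval (word_act (proper_word (x # w)) (counit :: (('p, 'q, 'n) symbol \<times> 'n) list \<Rightarrow> complex)) F
      = of_nat ?n" .
  have "?n \<noteq> 0 \<longleftrightarrow> (\<exists>l<length F. F ! l = x \<and> mset w = mset (?F l))"
    using n(2) by (auto split: if_splits)
  also have "\<dots> \<longleftrightarrow> mset (x # w) = mset F"
  proof
    assume "\<exists>l<length F. F ! l = x \<and> mset w = mset (?F l)"
    then show "mset (x # w) = mset F"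
      using mset_remove_nth by fastforce
  next
    assume eq: "mset (x # w) = mset F"
    then have "x \<in> set F" by (metis list.set_intros(1) set_mset_mset)
    then obtain l where l: "l < length F" "F ! l = x" by (auto simp: in_set_conv_nth)
    then show "\<exists>l<length F. F ! l = x \<and> mset w = mset (?F l)"
      using eq mset_remove_nth [of l F] by (intro exI [of _ l]) auto
  qed
  finally show ?case using * by blast
qed

lemma proper_supported_counit:
  "proper_supported (counit :: (('p, 'q, 'n) symbol \<times> 'n) list \<Rightarrow> complex)"
proof -
  have "fst ` set w \<inter> virtual = {}" if "counit w \<noteq> 0"
    for w :: "(('p, 'q, 'n) symbol \<times> 'n) list"
    using that by (induct w rule: counit.induct) (auto simp: virtual_def split: if_splits)
  then show ?thesis by (simp add: proper_supported_def)
qed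

section \<open>Linear functionals and the degree filtration\<close>

definition proper_pairing :: "('n \<times> 'n) list \<Rightarrow> ('p, 'q, 'n) env \<Rightarrow> complex" where
  "proper_pairing F x = diff_eval (env_act x counit) F"

lemma proper_pairing_add: "proper_pairing F (x + y) = proper_pairing F x + proper_pairing F y"
  by (simp add: proper_pairing_def diff_eval_add [symmetric] env_act_add [symmetric])

lemma proper_pairing_scalar: "proper_pairing F (scalar c * x) = c * proper_pairing F x"
proof -
  have "env_act (scalar c * x) counit = (\<lambda>v. c * env_act x counit v)"
    by (simp add: env_act_mult fun_eq_iff)
  then show ?thesis by (simp add: proper_pairing_def diff_eval_scale)
qed

lemma proper_pairing_0 [simp]: "proper_pairing F 0 = 0"
  using proper_pairing_scalar [of F 0 0] by simp

lemma proper_pairing_sum: "proper_pairing F (\<Sum>i\<in>A. f i) = (\<Sum>i\<in>A. proper_pairing F (f i))"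
  by (induct A rule: infinite_finite_induct) (simp_all add: proper_pairing_add)

text \<open>The degree filtration with index shifted by one: the strict bound makes
  \<open>filtration 0\<close> the zero space, where the induction of
  \<open>filtration_faithful\<close> starts.\<close>

definition filtration :: "nat \<Rightarrow> ('p, 'q, 'n) env set" where
  "filtration k = env.span {e_prod (proper_word w) | w. length w < k}"

lemma e_prod_in_filtration: "length w < k \<Longrightarrow> e_prod (proper_word w) \<in> filtration k"
  unfolding filtration_def by (rule env.span_base) blast

lemma filtration_mono: "k \<le> l \<Longrightarrow> filtration k \<subseteq> filtration l"
  unfolding filtration_def by (rule env.span_mono) auto

lemma proper_pairing_filtration:
  assumes "x \<in> filtration k" "k \<le> length F"
  shows "proper_pairing F x = 0"
  using assms(1) unfolding filtration_def
proof (induct rule: env.span_induct_alt)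
  case (step c x y)
  then obtain w where w: "x = e_prod (proper_word w)" "length w < k" by blast
  have "Suc (length w) \<le> length F" using w(2) assms(2) by simp
  then have "proper_pairing F x = 0"
    unfolding w(1) proper_pairing_def env_act_e_prod
    by (intro vanishes_word_act [unfolded vanishes_def, rule_format])
  then show ?case using step by (simp add: proper_pairing_add proper_pairing_scalar)
qed simp

lemma filtration_mult_left:
  assumes "x \<in> filtration k"
  shows "e_elt (Proper i) (Proper j) * x \<in> filtration (Suc k)"
  using assms unfolding filtration_def
proof (induct rule: env.span_induct_alt)
  case (step c x y)
  then obtain w where w: "x = e_prod (proper_word w)" "length w < k" by blast
  have "e_elt (Proper i) (Proper j) * x = e_prod (proper_word ((i, j) # w))"
    by (simp add: w e_prod_Cons)
  then have "e_elt (Proper i) (Proper j) * x \<in> filtration (Suc k)"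
    using w by (simp only:) (rule e_prod_in_filtration, simp)
  moreover have "e_elt (Proper i) (Proper j) * (scalar c * x + y) =
      scalar c * (e_elt (Proper i) (Proper j) * x) + e_elt (Proper i) (Proper j) * y"
    by (simp add: distrib_left mult_scalar_left)
  ultimately show ?case
    using step by (simp add: filtration_def env.span_add env.span_scale)
qed (simp add: env.span_zero)

text \<open>Proper letters are even, so a swap costs only bracket terms, and these are words shorter
  by one letter.\<close>

lemma e_prod_move:
  fixes x :: "'n \<times> 'n"
  shows "(e_prod (proper_word (x # u @ v)) :: ('p, 'q, 'n) env) - e_prod (proper_word (u @ x # v))
     \<in> filtration (Suc (length u + length v))"
proof (induct u)
  case Nil
  show ?case by (simp add: filtration_def env.span_zero)
next
  case (Cons y u)
  obtain i j k l where x: "x = (i, j)" and y: "y = (k, l)" by fastforce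
  let ?e = "\<lambda>w. e_prod (proper_word w) :: ('p, 'q, 'n) env"
  let ?f = "filtration (Suc (length (y # u) + length v)) :: ('p, 'q, 'n) env set"
  have sign: "(- 1) ^ (letter_degree (Proper i, Proper j) * letter_degree (Proper k, Proper l))
      = (1 :: ('p, 'q, 'n) env)" by simp
  have "?e (x # (y # u) @ v) - ?e ((y # u) @ x # v)
      = e_elt (Proper k) (Proper l) * (?e (x # u @ v) - ?e (u @ x # v))
        + (if j = k then ?e ((i, l) # u @ v) else 0)
        - (if i = l then ?e ((k, j) # u @ v) else 0)"
    using e_prod_swap [of "[] :: ('p, 'q, 'n) letter list" "Proper i" "Proper j" "Proper k" "Proper l"
        "proper_word (u @ v)"]
    unfolding sign append_Nil
    by (cases "i = l"; cases "j = k") (simp_all add: x y e_prod_Cons algebra_simps)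
  moreover have "e_elt (Proper k) (Proper l) * (?e (x # u @ v) - ?e (u @ x # v)) \<in> ?f"
    using filtration_mult_left [OF Cons] by simp
  moreover have "?e ((i, l) # u @ v) \<in> ?f" "?e ((k, j) # u @ v) \<in> ?f"
    by (rule e_prod_in_filtration; simp)+
  then have "(if j = k then ?e ((i, l) # u @ v) else 0) \<in> ?f"
    "(if i = l then ?e ((k, j) # u @ v) else 0) \<in> ?f"
    by (simp_all only: filtration_def env.span_zero split: if_split) simp_all
  ultimately show ?case
    unfolding filtration_def by (simp only: env.span_add env.span_diff)
qed

lemma e_prod_mset_cong:
  fixes v w :: "('n \<times> 'n) list"
  assumes "mset v = mset w"
  shows "(e_prod (proper_word v) :: ('p, 'q, 'n) env) - e_prod (proper_word w) \<in> filtration (length v)"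
  using assms
proof (induct v arbitrary: w)
  case Nil
  then show ?case by (simp add: filtration_def env.span_zero)
next
  case (Cons x v)
  let ?e = "\<lambda>w. e_prod (proper_word w) :: ('p, 'q, 'n) env"
  from Cons have "x \<in> set w" by (metis list.set_intros(1) set_mset_mset)
  then obtain w1 w2 where w: "w = w1 @ x # w2" by (auto simp: in_set_conv_decomp)
  then have m: "mset v = mset (w1 @ w2)" using Cons.prems by simp
  then have l: "length v = length w1 + length w2" by (metis length_append mset_eq_length)
  obtain i j where x: "x = (i, j)" by fastforce
  have "?e (x # v) - ?e (x # w1 @ w2) = e_elt (Proper i) (Proper j) * (?e v - ?e (w1 @ w2))"
    by (simp add: x e_prod_Cons algebra_simps)
  also have "\<dots> \<in> filtration (length (x # v))"
    using filtration_mult_left [OF Cons.hyps [OF m], of i j] by simp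
  finally have "(?e (x # v) - ?e (x # w1 @ w2)) + (?e (x # w1 @ w2) - ?e w)
      \<in> filtration (length (x # v))"
    using e_prod_move [of x w1 w2] l unfolding w filtration_def
    by (intro env.span_add) simp_all
  then show ?case by simp
qed

text \<open>Plays the role of the sorted monomial; no order on the letters is at hand.\<close>

definition representative :: "'a multiset \<Rightarrow> 'a list" where
  "representative m = (SOME w. mset w = m)"

lemma mset_representative [simp]: "mset (representative m) = m"
  unfolding representative_def by (rule someI_ex) (rule ex_mset)

lemma length_representative [simp]: "length (representative m) = size m"
  by (metis mset_representative size_mset)

text \<open>The spanning half of Poincare-Birkhoff-Witt, one degree at a time. Finiteness of
  \<open>'n\<close> makes the sum over multisets of size \<open>k\<close> finite.\<close>

lemma filtration_Suc:
  fixes x :: "('p, 'q, 'n::finite) env"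
  assumes "x \<in> filtration (Suc k)"
  shows "\<exists>c. x - (\<Sum>m\<in>mset ` {w. length w = k}.
    scalar (c m) * e_prod (proper_word (representative m))) \<in> filtration k"
  using assms unfolding filtration_def [of "Suc k"]
proof (induct rule: env.span_induct_alt)
  case base
  show ?case by (intro exI [of _ "\<lambda>m. 0"]) (simp add: filtration_def env.span_zero)
next
  case (step a x y)
  let ?A = "mset ` {w :: ('n \<times> 'n) list. length w = k}"
  let ?e = "\<lambda>m. e_prod (proper_word (representative m)) :: ('p, 'q, 'n) env"
  obtain w where w: "x = e_prod (proper_word w)" "length w < Suc k" using step(1) by blast
  obtain c where c: "y - (\<Sum>m\<in>?A. scalar (c m) * ?e m) \<in> filtration k" using step(2) by blast
  have fin: "finite ?A"
    using finite_lists_length_eq [of "UNIV :: ('n \<times> 'n) set" k] by simp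
  show ?case
  proof (cases "length w = k")
    case True
    let ?c = "\<lambda>m. c m + (if m = mset w then a else 0)"
    have "(\<Sum>m\<in>?A. scalar (?c m) * ?e m) =
        (\<Sum>m\<in>?A. scalar (c m) * ?e m + (if m = mset w then scalar a * ?e m else 0))"
      by (rule sum.cong) (auto simp: scalar_add algebra_simps)
    also have "\<dots> = (\<Sum>m\<in>?A. scalar (c m) * ?e m) + scalar a * ?e (mset w)"
      using True fin by (simp add: sum.distrib)
    finally have "scalar a * x + y - (\<Sum>m\<in>?A. scalar (?c m) * ?e m) =
        scalar a * (x - ?e (mset w)) + (y - (\<Sum>m\<in>?A. scalar (c m) * ?e m))"
      by (simp add: algebra_simps)
    also have "\<dots> \<in> filtration k"
      using c e_prod_mset_cong [of w "representative (mset w)"] True unfolding w(1) filtration_def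
      by (intro env.span_add env.span_scale) simp_all
    finally show ?thesis by (rule exI [of _ ?c])
  next
    case False
    then have "scalar a * x + (y - (\<Sum>m\<in>?A. scalar (c m) * ?e m)) \<in> filtration k"
      using c e_prod_in_filtration [of w k] w unfolding filtration_def
      by (intro env.span_add env.span_scale) simp_all
    then show ?thesis by (intro exI [of _ c]) (simp add: algebra_simps)
  qed
qed

text \<open>Pairing with \<open>representative m\<close>, of length \<open>k\<close>, kills the part
  in \<open>filtration k\<close> and every leading monomial but that of \<open>m\<close>. So all
  leading coefficients vanish and \<open>x\<close> drops to \<open>filtration k\<close>.\<close>

lemma filtration_faithful:
  fixes x :: "('p, 'q, 'n::finite) env"
  assumes "x \<in> filtration k" "\<And>F. proper_pairing F x = 0"
  shows "x = 0"
  using assms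
proof (induct k)
  case 0
  then show ?case by (simp add: filtration_def)
next
  case (Suc k)
  let ?A = "mset ` {w :: ('n \<times> 'n) list. length w = k}"
  let ?e = "\<lambda>m. e_prod (proper_word (representative m)) :: ('p, 'q, 'n) env"
  obtain c where c: "x - (\<Sum>m\<in>?A. scalar (c m) * ?e m) \<in> filtration k"
    using filtration_Suc [OF Suc.prems(1)] by blast
  have fin: "finite ?A"
    using finite_lists_length_eq [of "UNIV :: ('n \<times> 'n) set" k] by simp
  have "c m = 0" if m: "m \<in> ?A" for m
  proof -
    let ?F = "representative m"
    have sz: "size m = k" using m by auto
    have top: "\<exists>n. proper_pairing ?F (?e m') = of_nat n \<and> (n \<noteq> 0 \<longleftrightarrow> m' = m)" if "m' \<in> ?A" for m'
      using diff_eval_word_act_top [of "representative m'" ?F] that sz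
      by (auto simp: proper_pairing_def env_act_e_prod)
    have "proper_pairing ?F ((x - (\<Sum>m\<in>?A. scalar (c m) * ?e m)) + (\<Sum>m\<in>?A. scalar (c m) * ?e m)) = 0"
      using Suc.prems(2) by simp
    then have "(\<Sum>m'\<in>?A. c m' * proper_pairing ?F (?e m')) = 0"
      using proper_pairing_filtration [OF c, of ?F] sz
      unfolding proper_pairing_add by (simp add: proper_pairing_sum proper_pairing_scalar)
    also have "(\<Sum>m'\<in>?A. c m' * proper_pairing ?F (?e m')) =
        (\<Sum>m'\<in>?A. if m' = m then c m * proper_pairing ?F (?e m) else 0)"
      using top by (intro sum.cong) fastforce+
    finally have "c m * proper_pairing ?F (?e m) = 0"
      using m fin by simp
    then show "c m = 0" using top [OF m] by auto
  qed
  then have "x \<in> filtration k" using c by simp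
  then show ?case using Suc by blast
qed

lemma U_gl_filtration:
  fixes u :: "('p, 'q, 'n) env"
  assumes "u \<in> U_gl"
  shows "\<exists>k. u \<in> filtration k"
proof -
  let ?B = "{e_prod (proper_word w) | w. True} :: ('p, 'q, 'n) env set"
  have B: "(e_prod (proper_word w) :: ('p, 'q, 'n) env) \<in> env.span ?B" for w
    by (rule env.span_base) blast
  have mult: "x * y \<in> env.span ?B" if x: "x \<in> env.span ?B" and y: "y \<in> env.span ?B" for x y
    using x
  proof (induct rule: env.span_induct_alt)
    case (step c b x)
    then obtain v where v: "b = e_prod (proper_word v)" by blast
    have "b * y \<in> env.span ?B"
      using y
    proof (induct rule: env.span_induct_alt)
      case (step d b' z)
      then obtain w where w: "b' = e_prod (proper_word w)" by blast
      have "b * (scalar d * b' + z) = scalar d * e_prod (proper_word (v @ w)) + b * z"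
        unfolding v w by (simp add: distrib_left e_prod_append mult_scalar_left)
      moreover have "scalar d * e_prod (proper_word (v @ w)) + b * z \<in> env.span ?B"
        using step B by (intro env.span_add env.span_scale)
      ultimately show ?case by simp
    qed (simp add: env.span_zero)
    then show ?case using step by (simp add: distrib_right mult.assoc env.span_add env.span_scale)
  qed (simp add: env.span_zero)
  have "U_gl \<subseteq> env.span ?B"
    unfolding U_gl_def
  proof (rule hull_minimal)
    have "scalar c \<in> env.span ?B" for c
      using env.span_scale [OF B [of "[]"], of c] by simp
    then show "subalgebra (env.span ?B)"
      using mult by (auto simp: subalgebra_def env.span_add)
    show "{e_elt (Proper i) (Proper j) | i j. True} \<subseteq> env.span ?B"
      using B [of "[(_, _)]"] by (auto simp: e_prod_Cons)
  qed
  then have "u \<in> env.span ?B" using assms by blast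
  then show ?thesis
  proof (induct rule: env.span_induct_alt)
    case base
    show ?case by (intro exI [of _ 0]) (simp add: filtration_def)
  next
    case (step c x y)
    then obtain w k where w: "x = e_prod (proper_word w)" and k: "y \<in> filtration k" by blast
    have "x \<in> filtration (max k (Suc (length w)))" "y \<in> filtration (max k (Suc (length w)))"
      using k filtration_mono [of k "max k (Suc (length w))"] unfolding w
      by (auto intro: e_prod_in_filtration)
    then show ?case unfolding filtration_def by (blast intro: env.span_add env.span_scale)
  qed
qed

text \<open>Each functional \<open>proper_pairing F\<close> kills \<open>Irr\<close>, since
  \<open>counit\<close> is supported on proper words; jointly they separate the points of
  \<open>U_gl\<close>.\<close>

lemma U_gl_Int_Irr:
  fixes u :: "('p, 'q, 'n::finite) env"
  assumes "u \<in> U_gl" "u \<in> Irr"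
  shows "u = 0"
proof -
  have "proper_pairing F u = 0" for F
    by (simp add: proper_pairing_def Irr_act [OF assms(2) proper_supported_counit])
  then show ?thesis
    using U_gl_filtration [OF assms(1)] filtration_faithful by blast
qed

lemma devirt_eqI:
  fixes x :: "('p, 'q, 'n::finite) env"
  assumes "u \<in> U_gl" "x - u \<in> Irr"
  shows "devirt x = u"
  unfolding devirt_def
proof (rule the_equality)
  fix v :: "('p, 'q, 'n) env"
  assume v: "v \<in> U_gl \<and> x - v \<in> Irr"
  have "(x - u) - (x - v) \<in> Irr" by (rule Irr_diff [OF assms(2) conjunct2 [OF v]])
  moreover have "(x - u) - (x - v) = v - u" by (simp add: algebra_simps)
  ultimately have "v - u = 0"
    using U_gl_Int_Irr [OF U_gl_diff [OF conjunct1 [OF v] assms(1)]] by (simp only:)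
  then show "v = u" by simp
qed (simp add: assms)

section \<open>Balanced products\<close>

text \<open>Virtual symbols may even change type, so that one word over abstract names is a template
  for all choices; proper symbols stay fixed.\<close>

fun relabel :: "('a \<Rightarrow> 'p) \<Rightarrow> ('b \<Rightarrow> 'q) \<Rightarrow> ('a, 'b, 'n) letter \<Rightarrow> ('p, 'q, 'n) letter" where
  "relabel \<alpha> \<beta> (a, b) = (map_symbol \<alpha> \<beta> id a, map_symbol \<alpha> \<beta> id b)"

lemma degree_map_symbol [simp]: "degree (map_symbol \<alpha> \<beta> id a) = degree a"
  by (cases a) auto

lemma map_symbol_virtual: "a \<in> virtual \<Longrightarrow> map_symbol \<alpha> \<beta> id a \<in> virtual"
  by (auto simp: virtual_def)

lemma not_virtual_iff: "a \<notin> virtual \<longleftrightarrow> (\<exists>i. a = Proper i)"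
  by (cases a) (auto simp: virtual_def)

definition symbols :: "('p, 'q, 'n) letter list \<Rightarrow> ('p, 'q, 'n) symbol set" where
  "symbols w = fst ` set w \<union> snd ` set w"

lemma symbols_subset: "set w \<subseteq> P \<times> P \<Longrightarrow> symbols w \<subseteq> P"
  by (auto simp: symbols_def)

definition weight :: "('p, 'q, 'n) letter list \<Rightarrow> ('p, 'q, 'n) symbol \<Rightarrow> int" where
  "weight w \<gamma> = int (count_list (map fst w) \<gamma>) - int (count_list (map snd w) \<gamma>)"

lemma weight_Cons: "weight ((a, b) # w) \<gamma> = of_bool (a = \<gamma>) - of_bool (b = \<gamma>) + weight w \<gamma>"
  and weight_append: "weight (v @ w) \<gamma> = weight v \<gamma> + weight w \<gamma>"
  by (simp_all add: weight_def)

text \<open>\<open>weight w \<gamma>\<close> is the eigenvalue of \<open>e_prod w\<close> under the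
  commutator with \<open>e_elt \<gamma> \<gamma>\<close>. Bracket terms inherit weight zero, and a
  balanced word whose second entries are all proper is entirely proper.\<close>

definition balanced :: "('p, 'q, 'n) letter list \<Rightarrow> bool" where
  "balanced w \<longleftrightarrow> (\<forall>\<gamma>\<in>virtual. weight w \<gamma> = 0)"

lemma balanced_cong: "balanced v \<Longrightarrow> (\<And>\<gamma>. weight w \<gamma> = weight v \<gamma>) \<Longrightarrow> balanced w"
  by (simp add: balanced_def)

lemma irregular_snoc: "b \<in> virtual \<Longrightarrow> irregular (u @ [(a, b)])"
  unfolding irregular_def by (intro exI [of _ u] exI [of _ a] exI [of _ b] exI [of _ "[]"] bexI [of _ b]) auto

lemma e_prod_proper_in_U_gl:
  assumes "symbols w \<inter> virtual = {}"
  shows "e_prod w \<in> U_gl"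
  using assms
proof (induct w)
  case Nil
  show ?case using U_gl_scalar [of 1] by simp
next
  case (Cons x w)
  obtain a b where x: "x = (a, b)" by fastforce
  obtain i j where "a = Proper i" "b = Proper j"
    using Cons.prems not_virtual_iff [of a] not_virtual_iff [of b] by (auto simp: x symbols_def)
  moreover have "e_prod w \<in> U_gl" using Cons by (auto simp: symbols_def)
  ultimately show ?case by (simp add: x e_prod_Cons U_gl_mult e_elt_in_U_gl)
qed

text \<open>
  The part in \<^const>\<open>U_gl\<close> is the same for all names of the virtual symbols. The factors \<open>e\<^bsub>a,b\<^esub>\<close> with
  \<open>b\<close> virtual are moved to the far right, where they make the product irregular; the bracket terms
  are again balanced and shorter.
\<close>

lemma balanced_devirt:
  fixes w :: "('a, 'b, 'n) letter list"
  assumes "balanced w"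
  shows "\<exists>u\<in>U_gl. \<forall>\<alpha> \<beta>. inj_on (map_symbol \<alpha> \<beta> id) (symbols w) \<longrightarrow>
    (e_prod (map (relabel \<alpha> \<beta>) w) :: ('p, 'q, 'n) env) - u \<in> Irr"
  using assms
proof (induct "length w" arbitrary: w rule: less_induct)
  case less
  define Q where "Q w u \<longleftrightarrow> u \<in> U_gl \<and> (\<forall>\<alpha> \<beta>. inj_on (map_symbol \<alpha> \<beta> id) (symbols w) \<longrightarrow>
    (e_prod (map (relabel \<alpha> \<beta>) w) :: ('p, 'q, 'n) env) - u \<in> Irr)"
    for w :: "('a, 'b, 'n) letter list" and u
  have IH: "\<exists>u. Q w' u" if "length w' < length w" "balanced w'" for w'
    using less.hyps [OF that] unfolding Q_def by blast
  have move: "\<exists>z. Q (u @ (a, b) # v) z"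
    if "b \<in> virtual" "length (u @ (a, b) # v) = length w" "balanced (u @ (a, b) # v)" for u a b v
    using that(2,3)
  proof (induct v arbitrary: u)
    case Nil
    have "Q (u @ [(a, b)]) 0"
      by (auto simp: Q_def U_gl_0
          intro!: irregular_in_Irr irregular_snoc map_symbol_virtual that(1))
    then show ?case by blast
  next
    case (Cons y v)
    obtain c d where y: "y = (c, d)" by fastforce
    let ?w = "u @ (a, b) # (c, d) # v"
    let ?s = "(- 1) ^ (letter_degree (a, b) * letter_degree (c, d)) :: ('p, 'q, 'n) env"
    have bal: "balanced ?w" using Cons.prems(2) by (simp add: y)
    then have "balanced ((u @ [(c, d)]) @ (a, b) # v)"
      by (rule balanced_cong) (simp add: weight_Cons weight_append)
    then obtain z1 where z1: "Q ((u @ [(c, d)]) @ (a, b) # v) z1"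
      using Cons.hyps [of "u @ [(c, d)]"] Cons.prems(1) by (auto simp: y)
    \<comment> \<open>The implication makes the bracket term optional: any \<open>z\<close> will do
      when it does not arise.\<close>
    have "\<exists>z. b = c \<longrightarrow> Q (u @ (a, d) # v) z"
    proof (cases "b = c")
      case True
      have "balanced (u @ (a, d) # v)"
        by (rule balanced_cong [OF bal]) (simp add: True weight_Cons weight_append)
      then show ?thesis using IH [of "u @ (a, d) # v"] Cons.prems(1) by auto
    qed blast
    then obtain z2 where z2: "b = c \<Longrightarrow> Q (u @ (a, d) # v) z2" by blast
    have "\<exists>z. a = d \<longrightarrow> Q (u @ (c, b) # v) z"
    proof (cases "a = d")
      case True
      have "balanced (u @ (c, b) # v)"
        by (rule balanced_cong [OF bal]) (simp add: True weight_Cons weight_append)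
      then show ?thesis using IH [of "u @ (c, b) # v"] Cons.prems(1) by auto
    qed blast
    then obtain z3 where z3: "a = d \<Longrightarrow> Q (u @ (c, b) # v) z3" by blast
    let ?z = "?s * z1 + (if b = c then z2 else 0) - ?s * (if a = d then z3 else 0)"
    have s: "?s = of_int ((- 1) ^ (letter_degree (a, b) * letter_degree (c, d)))" by simp
    have "?z \<in> U_gl"
      using z1 z2 z3 unfolding s Q_def
      by (intro U_gl_add U_gl_diff U_gl_mult U_gl_of_int) (auto intro: U_gl_0)
    moreover have "e_prod (map (relabel \<alpha> \<beta>) ?w) - ?z \<in> Irr"
      if inj: "inj_on (map_symbol \<alpha> \<beta> id) (symbols ?w)" for \<alpha> \<beta>
    proof -
      let ?m = "map_symbol \<alpha> \<beta> id" and ?e = "\<lambda>w. e_prod (map (relabel \<alpha> \<beta>) w) :: ('p, 'q, 'n) env"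
      \<comment> \<open>Injectivity enters here: renaming neither creates nor destroys bracket
        terms, so the recursion is the same for all names.\<close>
      have eq: "?m b = ?m c \<longleftrightarrow> b = c" "?m a = ?m d \<longleftrightarrow> a = d"
        by (rule inj_on_eq_iff [OF inj]; simp add: symbols_def)+
      have sub: "symbols ((u @ [(c, d)]) @ (a, b) # v) \<subseteq> symbols ?w"
        "symbols (u @ (a, d) # v) \<subseteq> symbols ?w" "symbols (u @ (c, b) # v) \<subseteq> symbols ?w"
        by (auto simp: symbols_def)
      have E: "?e ?w = ?s * ?e ((u @ [(c, d)]) @ (a, b) # v)
          + (if b = c then ?e (u @ (a, d) # v) else 0)
          - ?s * (if a = d then ?e (u @ (c, b) # v) else 0)"
        using e_prod_swap [of "map (relabel \<alpha> \<beta>) u" "?m a" "?m b" "?m c" "?m d" "map (relabel \<alpha> \<beta>) v"]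
        by (simp add: eq cong: if_cong)
      have "?e ?w - ?z = ?s * (?e ((u @ [(c, d)]) @ (a, b) # v) - z1)
          + (if b = c then ?e (u @ (a, d) # v) - z2 else 0)
          - ?s * (if a = d then ?e (u @ (c, b) # v) - z3 else 0)"
        unfolding E by (simp add: algebra_simps del: letter_degree.simps)
      also have "\<dots> \<in> Irr"
      proof (rule Irr_diff [OF Irr_add [OF Irr_mult] Irr_mult])
        have QD: "?e w' - z \<in> Irr" if "Q w' z" "symbols w' \<subseteq> symbols ?w" for w' z
          using that(1) inj_on_subset [OF inj that(2)] by (simp add: Q_def)
        show "?e ((u @ [(c, d)]) @ (a, b) # v) - z1 \<in> Irr"
          by (rule QD [OF z1 sub(1)])
        show "(if b = c then ?e (u @ (a, d) # v) - z2 else 0) \<in> Irr"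
          using QD [OF z2 sub(2)] Irr_0 by (simp only: split: if_split) blast
        show "(if a = d then ?e (u @ (c, b) # v) - z3 else 0) \<in> Irr"
          using QD [OF z3 sub(3)] Irr_0 by (simp only: split: if_split) blast
      qed
      finally show ?thesis .
    qed
    ultimately show ?case unfolding y Q_def by blast
  qed
  have "\<exists>z. Q w z"
  proof (cases "snd ` set w \<inter> virtual = {}")
    case True
    then have snd0: "count_list (map snd w) \<gamma> = 0" if "\<gamma> \<in> virtual" for \<gamma>
      using that by (auto simp: count_list_0_iff)
    have "fst ` set w \<inter> virtual = {}"
    proof (intro equals0I)
      fix \<gamma>
      assume \<gamma>: "\<gamma> \<in> fst ` set w \<inter> virtual"
      then have "count_list (map fst w) \<gamma> = 0"
        using less.prems snd0 [of \<gamma>] by (simp add: balanced_def weight_def)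
      then show False
        using \<gamma> by (simp add: count_list_0_iff)
    qed
    with True have p: "symbols w \<inter> virtual = {}" by (auto simp: symbols_def)
    \<comment> \<open>All relabellings agree on proper letters; \<open>undefined\<close> only picks
      one of them.\<close>
    let ?r = "relabel (undefined :: 'a \<Rightarrow> 'p) (undefined :: 'b \<Rightarrow> 'q)"
    have no_virtual: "relabel \<alpha> \<beta> x = ?r x \<and> symbols [?r x] \<inter> virtual = {}" if "x \<in> set w"
      for x :: "('a, 'b, 'n) letter" and \<alpha> \<beta>
    proof -
      obtain a b where x: "x = (a, b)" by fastforce
      with that p have "a \<notin> virtual" "b \<notin> virtual" by (force simp: symbols_def)+
      then obtain i j where "a = Proper i" "b = Proper j" by (auto simp: not_virtual_iff)
      then show ?thesis by (auto simp: x symbols_def virtual_def)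
    qed
    have "(e_prod (map (relabel \<alpha> \<beta>) w) :: ('p, 'q, 'n) env) - e_prod (map ?r w) \<in> Irr" for \<alpha> \<beta>
    proof -
      have "map (relabel \<alpha> \<beta>) w = map ?r w"
        by (rule map_cong [OF refl]) (rule conjunct1 [OF no_virtual])
      then show ?thesis by (simp only: diff_self Irr_0)
    qed
    moreover have "symbols (map ?r w) = (\<Union>x\<in>set w. symbols [?r x])"
      by (auto simp: symbols_def)
    then have "symbols (map ?r w) \<inter> virtual = {}"
      using conjunct2 [OF no_virtual] by blast
    ultimately have "Q w (e_prod (map ?r w))"
      using e_prod_proper_in_U_gl unfolding Q_def by blast
    then show ?thesis by blast
  next
    case False
    then obtain x where "x \<in> set w" "snd x \<in> virtual" by blast
    moreover then obtain u v where "w = u @ x # v" by (auto simp: in_set_conv_decomp)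
    ultimately show ?thesis using move [of "snd x" u "fst x" v] less.prems by simp
  qed
  then show ?case unfolding Q_def by blast
qed


section \<open>Polarizing a row\<close>

text \<open>Compatible with sums and left multiplication; hence the lemmas below carry their
  right-hand context \<open>zs\<close> along.\<close>

definition irr_eq :: "('p, 'q, 'n) env \<Rightarrow> ('p, 'q, 'n) env \<Rightarrow> bool" where
  "irr_eq x y \<longleftrightarrow> x - y \<in> Irr"

lemma irr_eq_refl: "irr_eq x x"
  by (simp add: irr_eq_def Irr_0)

lemma irr_eq_trans [trans]: "irr_eq x y \<Longrightarrow> irr_eq y z \<Longrightarrow> irr_eq x z"
  using Irr_add [of "x - y" "y - z"] by (simp add: irr_eq_def)

lemma irr_eq_add: "irr_eq x y \<Longrightarrow> irr_eq x' y' \<Longrightarrow> irr_eq (x + x') (y + y')"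
  using Irr_add [of "x - y" "x' - y'"] by (simp add: irr_eq_def algebra_simps)

lemma irr_eq_mult: "irr_eq x y \<Longrightarrow> irr_eq (r * x) (r * y)"
  using Irr_mult [of "x - y" r] by (simp add: irr_eq_def algebra_simps)

lemma irr_eq_sum: "(\<And>i. i \<in> A \<Longrightarrow> irr_eq (f i) (g i)) \<Longrightarrow> irr_eq (sum f A) (sum g A)"
  using Irr_sum [of A "\<lambda>i. f i - g i"] by (simp add: irr_eq_def sum_subtractf)

lemma irregular_Cons:
  "b \<in> virtual \<Longrightarrow> b \<notin> fst ` set v \<Longrightarrow> irregular ((a, b) # v)"
  unfolding irregular_def
  by (intro exI [of _ "[]"] exI [of _ a] exI [of _ b] exI [of _ v] bexI [of _ b])
    (auto simp: count_list_0_iff)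

lemma e_prod_commute_letter:
  assumes "\<And>y. y \<in> set us \<Longrightarrow> snd x \<noteq> fst y \<and> fst x \<noteq> snd y"
  shows "e_prod (u @ x # us @ v) =
    (- 1) ^ (letter_degree x * sum_list (map letter_degree us)) * e_prod (u @ us @ x # v)"
  using assms
proof (induct us arbitrary: u)
  case (Cons y us)
  obtain a b c d where x: "x = (a, b)" and y: "y = (c, d)" by fastforce
  have "e_prod (u @ x # (y # us) @ v) = (- 1) ^ (letter_degree x * letter_degree y) *
      e_prod ((u @ [y]) @ x # us @ v)"
    using e_prod_swap [of u a b c d "us @ v"] Cons.prems [of y] by (simp add: x y)
  also have "e_prod ((u @ [y]) @ x # us @ v) =
      (- 1) ^ (letter_degree x * sum_list (map letter_degree us)) * e_prod ((u @ [y]) @ us @ x # v)"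
    using Cons.prems by (intro Cons.hyps) simp
  finally show ?case
    by (simp add: distrib_left power_add mult.assoc)
qed simp

lemma e_prod_commute_words:
  assumes "\<And>x y. x \<in> set xs \<Longrightarrow> y \<in> set ys \<Longrightarrow> snd x \<noteq> fst y \<and> fst x \<noteq> snd y"
  shows "e_prod (u @ xs @ ys @ v) =
    (- 1) ^ (sum_list (map letter_degree xs) * sum_list (map letter_degree ys)) *
      e_prod (u @ ys @ xs @ v)"
  using assms
proof (induct xs arbitrary: v rule: rev_induct)
  case (snoc x xs)
  have "e_prod (u @ (xs @ [x]) @ ys @ v) = e_prod ((u @ xs) @ x # ys @ v)" by simp
  also have "\<dots> = (- 1) ^ (letter_degree x * sum_list (map letter_degree ys)) *
      e_prod (u @ xs @ ys @ x # v)"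
    using snoc.prems by (subst e_prod_commute_letter) auto
  also have "e_prod (u @ xs @ ys @ x # v) =
    (- 1) ^ (sum_list (map letter_degree xs) * sum_list (map letter_degree ys)) *
      e_prod (u @ ys @ xs @ x # v)"
    using snoc.prems by (intro snoc.hyps) auto
  finally show ?case
    by (simp add: distrib_right power_add add.commute [of _ "letter_degree x"] mult.assoc)
qed simp

definition from_row :: "'p \<Rightarrow> 'n list \<Rightarrow> ('p, 'q, 'n) letter list" where
  "from_row c ts = map (\<lambda>t. (Pos c, Proper t)) ts"

definition to_row :: "'q list \<Rightarrow> 'p \<Rightarrow> ('p, 'q, 'n) letter list" where
  "to_row ds c = map (\<lambda>d. (Neg d, Pos c)) ds"

definition pair_row :: "'q list \<Rightarrow> 'n list \<Rightarrow> ('p, 'q, 'n) letter list" where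
  "pair_row ds ts = zip (map Neg ds) (map Proper ts)"

lemma degree_from_row: "sum_list (map letter_degree (from_row c ts)) = length ts"
  by (induct ts) (simp_all add: from_row_def)

text \<open>The sign \<open>(- 1) ^ b\<close> is the cost of passing \<open>b\<close> odd factors
  before hitting the entry at position \<open>b\<close>; the resulting factor is even and moves to
  the end of the row for free. The assumption on \<open>zs\<close> makes the last remainder
  irregular.\<close>

lemma polarize_from_row:
  fixes zs :: "('p, 'q, 'n) letter list"
  assumes "Pos c \<notin> fst ` set zs"
  shows "irr_eq (e_prod ((Neg d, Pos c) # from_row c ts @ zs))
    (\<Sum>b<length ts. (- 1) ^ b *
      e_prod (from_row c (take b ts @ drop (Suc b) ts) @ (Neg d, Proper (ts ! b)) # zs))"
proof (induct ts)
  case Nil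
  have "irregular ((Neg d, Pos c) # zs)"
    using assms by (intro irregular_Cons) (auto simp: virtual_def)
  then show ?case by (simp add: from_row_def irr_eq_def irregular_in_Irr)
next
  case (Cons t ts)
  let ?y = "(Pos c, Proper t) :: ('p, 'q, 'n) letter"
  let ?f = "\<lambda>ts b. (- 1) ^ b *
      e_prod (from_row c (take b ts @ drop (Suc b) ts) @ (Neg d, Proper (ts ! b)) # zs)"
  have step: "e_prod ((Neg d, Pos c) # from_row c (t # ts) @ zs) =
      e_prod ((Neg d, Proper t) # from_row c ts @ zs)
      + - e_elt (Pos c) (Proper t) * e_prod ((Neg d, Pos c) # from_row c ts @ zs)"
    using e_prod_swap [of "[]" "Neg d" "Pos c" "Pos c" "Proper t" "from_row c ts @ zs"]
    by (simp add: from_row_def e_prod_Cons)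
  have head: "e_prod ((Neg d, Proper t) # from_row c ts @ zs)
      = e_prod (from_row c ts @ (Neg d, Proper t) # zs)"
  proof -
    have "snd (Neg d, Proper t) \<noteq> fst y \<and> fst (Neg d, Proper t) \<noteq> snd y"
      if "y \<in> set (from_row c ts)" for y :: "('p, 'q, 'n) letter"
      using that by (auto simp: from_row_def)
    from e_prod_commute_letter [OF this, where u = "[]" and v = zs] show ?thesis
      by (simp add: degree_from_row)
  qed
  have tail: "irr_eq (- e_elt (Pos c) (Proper t) * e_prod ((Neg d, Pos c) # from_row c ts @ zs))
      (- e_elt (Pos c) (Proper t) * (\<Sum>b<length ts. ?f ts b))"
    by (intro irr_eq_mult Cons)
  have shift: "- e_elt (Pos c) (Proper t) * (\<Sum>b<length ts. ?f ts b) =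
      (\<Sum>b<length ts. ?f (t # ts) (Suc b))"
  proof -
    have "- e_elt (Pos c) (Proper t) * ?f ts b = ?f (t # ts) (Suc b)" for b
      by (cases "even b") (simp_all add: from_row_def e_prod_Cons)
    then show ?thesis by (simp only: sum_distrib_left)
  qed
  have "?f (t # ts) 0 = e_prod (from_row c ts @ (Neg d, Proper t) # zs)" by simp
  then have "irr_eq (e_prod ((Neg d, Pos c) # from_row c (t # ts) @ zs))
      (?f (t # ts) 0 + (\<Sum>b<length ts. ?f (t # ts) (Suc b)))"
    unfolding step head shift [symmetric] by (simp only: irr_eq_add irr_eq_refl tail)
  then show ?case
    by (simp only: sum.lessThan_Suc_shift list.size add_0_right add_Suc_right)
qed

text \<open>The factor of \<open>t\<close> passes \<open>length ts - Suc b\<close> odd factors.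
  Together with \<open>(- 1) ^ b\<close> this gives a sign independent of \<open>b\<close>; the
  minus in front becomes the signature of a transposition.\<close>

lemma from_row_update:
  fixes zs :: "('p, 'q, 'n) letter list"
  assumes "b < length ts"
  shows "(- 1) ^ b * e_prod (u @ from_row c (take b ts @ drop (Suc b) ts @ [t]) @ zs) =
    - ((- 1) ^ length ts * e_prod (u @ from_row c (ts[b := t]) @ zs))"
proof -
  have "e_prod (u @ from_row c (ts[b := t]) @ zs) =
      e_prod ((u @ from_row c (take b ts)) @ (Pos c, Proper t) # from_row c (drop (Suc b) ts) @ zs)"
    using assms by (simp add: upd_conv_take_nth_drop from_row_def)
  also have "\<dots> = (- 1) ^ (length ts - Suc b) *
      e_prod (u @ from_row c (take b ts @ drop (Suc b) ts @ [t]) @ zs)"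
    by (subst e_prod_commute_letter, force simp: from_row_def)
      (simp add: degree_from_row, simp add: from_row_def)
  finally have "(- 1) ^ length ts * e_prod (u @ from_row c (ts[b := t]) @ zs) =
      (- 1) ^ (length ts + (length ts - Suc b)) *
      e_prod (u @ from_row c (take b ts @ drop (Suc b) ts @ [t]) @ zs)"
    by (simp add: power_add mult.assoc)
  also have "(- 1) ^ (length ts + (length ts - Suc b)) = - ((- 1) ^ b :: ('p, 'q, 'n) env)"
    using assms by (cases "even b"; cases "even (length ts)") (simp_all add: power_add)
  finally show ?thesis by simp
qed

text \<open>
  Pairing the last \<open>d\<close> with the entry at position \<open>b\<close>, and moving the last entry to position \<open>b\<close>,
  corresponds to the factorization \<open>\<sigma> = transpose k b \<circ> q\<close> with \<open>q\<close> fixing \<open>k\<close>.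
\<close>

lemma polarize_row:
  fixes zs :: "('p, 'q, 'n) letter list"
  assumes "length ts = length ds" "Pos c \<notin> fst ` set zs"
  shows "irr_eq (e_prod (to_row ds c @ from_row c ts @ zs))
    ((- 1) ^ (length ds choose 2) *
      (\<Sum>\<sigma> | \<sigma> permutes {..<length ds}. of_int (sign \<sigma>) * e_prod (pair_row ds (permute_list \<sigma> ts) @ zs)))"
  using assms
proof (induct ds arbitrary: ts zs rule: rev_induct)
  case Nil
  then show ?case
    by (simp add: to_row_def from_row_def pair_row_def irr_eq_refl numeral_2_eq_2)
next
  case (snoc d ds)
  obtain ts' t where ts: "ts = ts' @ [t]" and len: "length ts' = length ds"
    using snoc.prems(1) by (cases ts rule: rev_cases) auto
  let ?k = "length ds"
  \<comment> \<open>The signature of \<open>transpose ?k b\<close>, which is the identity for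
    \<open>b = ?k\<close>.\<close>
  let ?s = "\<lambda>b. if b = ?k then 1 else - 1 :: int"
  let ?z = "\<lambda>b. (Neg d, Proper (ts ! b)) # zs"
  let ?c = "(- 1) ^ (?k choose 2) :: int"
  let ?P = "\<lambda>\<sigma>. of_int (sign \<sigma>) * e_prod (pair_row (ds @ [d]) (permute_list \<sigma> ts) @ zs)"
  have "irr_eq (e_prod (to_row ds c) * e_prod ((Neg d, Pos c) # from_row c ts @ zs))
     (e_prod (to_row ds c) * (\<Sum>b<length ts. (- 1) ^ b *
      e_prod (from_row c (take b ts @ drop (Suc b) ts) @ ?z b)))"
    using snoc.prems by (intro irr_eq_mult polarize_from_row)
  also have "e_prod (to_row ds c) * (\<Sum>b<length ts. (- 1) ^ b *
      e_prod (from_row c (take b ts @ drop (Suc b) ts) @ ?z b)) =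
      (\<Sum>b<Suc ?k. (- 1) ^ b * e_prod (to_row ds c @ from_row c (take b ts @ drop (Suc b) ts) @ ?z b))"
    unfolding sum_distrib_left
  proof (rule sum.cong)
    fix b
    show "e_prod (to_row ds c) * ((- 1) ^ b *
        e_prod (from_row c (take b ts @ drop (Suc b) ts) @ ?z b)) =
      (- 1) ^ b * e_prod (to_row ds c @ from_row c (take b ts @ drop (Suc b) ts) @ ?z b)"
      by (cases "even b") (simp_all add: e_prod_append)
  qed (simp add: ts len)
  \<comment> \<open>For \<open>b = ?k\<close> the update of \<open>ts'\<close> is out of range and
    changes nothing, so one formula also covers the pairing of \<open>d\<close> with the last
    entry.\<close>
  also have "\<dots> = (\<Sum>b<Suc ?k. of_int ((- 1) ^ ?k * ?s b) *
      e_prod (to_row ds c @ from_row c (ts'[b := t]) @ ?z b))"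
  proof (rule sum.cong)
    fix b
    assume "b \<in> {..<Suc ?k}"
    then consider "b = ?k" | "b < ?k" by fastforce
    then show "(- 1) ^ b * e_prod (to_row ds c @ from_row c (take b ts @ drop (Suc b) ts) @ ?z b) =
      of_int ((- 1) ^ ?k * ?s b) * e_prod (to_row ds c @ from_row c (ts'[b := t]) @ ?z b)"
    proof cases
      case 1
      then show ?thesis by (simp add: ts len list_update_beyond)
    next
      case 2
      then show ?thesis
        using from_row_update [of b ts' "to_row ds c" c t "?z b"] by (simp add: ts len)
    qed
  qed simp
  also have "irr_eq \<dots> (\<Sum>b<Suc ?k. of_int ((- 1) ^ ?k * ?s b) * (of_int ?c *
      (\<Sum>\<sigma> | \<sigma> permutes {..<?k}. of_int (sign \<sigma>) * e_prod (pair_row ds (permute_list \<sigma> (ts'[b := t])) @ ?z b))))"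
  proof (intro irr_eq_sum irr_eq_mult)
    fix b
    show "irr_eq (e_prod (to_row ds c @ from_row c (ts'[b := t]) @ ?z b)) (of_int ?c *
      (\<Sum>\<sigma> | \<sigma> permutes {..<?k}. of_int (sign \<sigma>) * e_prod (pair_row ds (permute_list \<sigma> (ts'[b := t])) @ ?z b)))"
      using snoc.hyps [of "ts'[b := t]" "?z b"] snoc.prems(2) len by simp
  qed
  also have "\<dots> = (\<Sum>b<Suc ?k. \<Sum>\<sigma> | \<sigma> permutes {..<?k}. of_int ((- 1) ^ ?k * ?c) * ?P (transpose ?k b \<circ> \<sigma>))"
    unfolding sum_distrib_left
  proof (intro sum.cong refl)
    fix b \<sigma>
    assume b: "b \<in> {..<Suc ?k}" and "\<sigma> \<in> {\<sigma>. \<sigma> permutes {..<?k}}"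
    then have \<sigma>: "\<sigma> permutes {..<?k}" by simp
    have "sign (transpose ?k b \<circ> \<sigma>) = ?s b * sign \<sigma>"
      using \<sigma> by (subst sign_compose) (auto simp: sign_swap_id permutation_swap_id
          intro: permutation_permutes [THEN iffD2])
    moreover have "permute_list (transpose ?k b \<circ> \<sigma>) ts = permute_list \<sigma> (ts'[b := t]) @ [ts ! b]"
    proof (rule nth_equalityI)
      fix i
      assume "i < length (permute_list (transpose ?k b \<circ> \<sigma>) ts)"
      then consider "i = ?k" | "i < ?k" "\<sigma> i < ?k"
        using permutes_in_image [OF \<sigma>, of i] by (fastforce simp: ts len)
      then show "permute_list (transpose ?k b \<circ> \<sigma>) ts ! i = (permute_list \<sigma> (ts'[b := t]) @ [ts ! b]) ! i"
      proof cases
        case 1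
        then have "\<sigma> i = i" using \<sigma> by (simp add: permutes_not_in)
        then show ?thesis
          using 1 by (simp add: permute_list_def ts len nth_append)
      next
        case 2
        then show ?thesis
          by (auto simp: permute_list_def ts len nth_append nth_list_update transpose_def)
      qed
    qed (simp add: ts)
    then have pair: "pair_row (ds @ [d]) (permute_list (transpose ?k b \<circ> \<sigma>) ts) @ zs =
        pair_row ds (permute_list \<sigma> (ts'[b := t])) @ ?z b"
      by (simp add: pair_row_def len)
    moreover have "of_int (m * r) * (of_int n * (of_int s * x)) = of_int (m * n) * (of_int (r * s) * x)"
      for m n r s and x :: "('p, 'q, 'n) env"
      by (simp only: mult.assoc [symmetric] of_int_mult [symmetric]) (simp only: ac_simps)
    ultimately show "of_int ((- 1) ^ ?k * ?s b) * (of_int ?c * (of_int (sign \<sigma>) *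
        e_prod (pair_row ds (permute_list \<sigma> (ts'[b := t])) @ ?z b))) =
      of_int ((- 1) ^ ?k * ?c) * ?P (transpose ?k b \<circ> \<sigma>)"
      by (simp only: pair)
  qed
  also have "\<dots> = of_int ((- 1) ^ ?k * ?c) * (\<Sum>\<sigma> | \<sigma> permutes {..<Suc ?k}. ?P \<sigma>)"
  proof -
    have "(\<Sum>\<sigma> | \<sigma> permutes {..<Suc ?k}. ?P \<sigma>) =
        (\<Sum>b<Suc ?k. \<Sum>\<sigma> | \<sigma> permutes {..<?k}. ?P (transpose ?k b \<circ> \<sigma>))"
      unfolding lessThan_Suc by (rule sum_over_permutations_insert) simp_all
    then show ?thesis by (simp only: sum_distrib_left)
  qed
  \<comment> \<open>Pascal's rule: \<open>Suc k choose 2 = k + (k choose 2)\<close>.\<close>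
  also have "(of_int ((- 1) ^ ?k * ?c) :: ('p, 'q, 'n) env) = (- 1) ^ (length (ds @ [d]) choose 2)"
    by (simp add: numeral_2_eq_2 power_add)
  finally show ?case
    by (simp add: to_row_def e_prod_append)
qed


section \<open>Polarizing a tableau\<close>

text \<open>Removing the first row renumbers the rows, so \<open>\<alpha>\<close> is shifted;
  \<open>\<beta>\<close> is indexed by columns and stays in \<open>D_tab_Cons\<close>.\<close>

lemma C_tab_Cons: "C_tab \<alpha> (k # lam) = replicate k (Pos (\<alpha> 0)) # C_tab (\<alpha> \<circ> Suc) lam"
  by (simp add: C_tab_def upt_conv_Cons map_Suc_upt [symmetric] del: upt_Suc)

lemma D_tab_Cons: "D_tab \<beta> (k # lam) = map (\<lambda>c. Neg (\<beta> c)) [0..<k] # D_tab \<beta> lam"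
  by (simp add: D_tab_def)

lemma permute_rows_Cons: "permute_rows \<sigma> (t # T) = permute_list (\<sigma> 0) t # permute_rows (\<sigma> \<circ> Suc) T"
  by (simp add: permute_rows_def upt_conv_Cons map_Suc_upt [symmetric] del: upt_Suc)

lemma row_sign_Cons: "row_sign (k # lam) \<sigma> = sign (\<sigma> 0) * row_sign lam (\<sigma> \<circ> Suc)"
  by (simp add: row_sign_def prod.lessThan_Suc_shift del: prod.lessThan_Suc)

lemma sum_row_perms_Cons:
  "(\<Sum>\<sigma>\<in>row_perms (k # lam). f (\<sigma> 0) (\<sigma> \<circ> Suc)) =
    (\<Sum>\<sigma>\<in>row_perms lam. \<Sum>p | p permutes {..<k}. f p \<sigma>)"
proof -
  have "(\<Sum>\<sigma>\<in>row_perms (k # lam). f (\<sigma> 0) (\<sigma> \<circ> Suc)) =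
      (\<Sum>(\<sigma>, p)\<in>row_perms lam \<times> {p. p permutes {..<k}}. f p \<sigma>)"
  proof (rule sum.reindex_bij_witness [of _ "\<lambda>(\<sigma>, p). case_nat p \<sigma>" "\<lambda>\<sigma>. (\<sigma> \<circ> Suc, \<sigma> 0)"])
    fix \<sigma>
    assume \<sigma>: "\<sigma> \<in> row_perms (k # lam)"
    show "(case (\<sigma> \<circ> Suc, \<sigma> 0) of (\<sigma>, p) \<Rightarrow> case_nat p \<sigma>) = \<sigma>"
      by (simp add: fun_eq_iff split: nat.split)
    show "(\<sigma> \<circ> Suc, \<sigma> 0) \<in> row_perms lam \<times> {p. p permutes {..<k}}"
      using \<sigma> by (force simp: row_perms_def PiE_iff extensional_def)
  next
    fix x
    assume x: "x \<in> row_perms lam \<times> {p. p permutes {..<k}}"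
    then show "(case x of (\<sigma>, p) \<Rightarrow> case_nat p \<sigma>) \<in> row_perms (k # lam)"
      by (auto simp: row_perms_def PiE_iff extensional_def nth_Cons split: nat.split prod.split)
    show "((case x of (\<sigma>, p) \<Rightarrow> case_nat p \<sigma>) \<circ> Suc, (case x of (\<sigma>, p) \<Rightarrow> case_nat p \<sigma>) 0) = x"
      by (auto split: prod.split)
  qed auto
  then show ?thesis by (simp add: sum.cartesian_product)
qed

lemma length_concat_shape: "length (concat T) = sum_list (shape T)"
  by (simp add: length_concat shape_def)

lemma shape_C_tab: "shape (C_tab \<alpha> lam) = lam"
  by (simp add: shape_def C_tab_def comp_def map_nth)

lemma shape_D_tab: "shape (D_tab \<beta> lam) = lam"
  by (simp add: shape_def D_tab_def comp_def)

lemma shape_proper_tab: "shape (proper_tab T) = shape T"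
  by (simp add: shape_def proper_tab_def comp_def)

lemma shape_permute_rows: "shape (permute_rows \<sigma> T) = shape T"
  by (rule nth_equalityI) (simp_all add: shape_def permute_rows_def)

definition tab_word ::
  "('p, 'q, 'n) symbol list list \<Rightarrow> ('p, 'q, 'n) symbol list list \<Rightarrow> ('p, 'q, 'n) letter list" where
  "tab_word S T = zip (concat S) (concat T)"

lemma e_tab_eq: "e_tab S T = e_prod (tab_word S T)"
  by (simp add: e_tab_def tab_word_def)

lemma tab_word_Cons: "length s = length t \<Longrightarrow> tab_word (s # S) (t # T) = zip s t @ tab_word S T"
  by (simp add: tab_word_def)

lemma tab_word_D_C_Cons:
  "tab_word (D_tab \<beta> (k # lam)) (C_tab \<alpha> (k # lam)) =
    to_row (map \<beta> [0..<k]) (\<alpha> 0) @ tab_word (D_tab \<beta> lam) (C_tab (\<alpha> \<circ> Suc) lam)"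
  by (simp add: D_tab_Cons C_tab_Cons tab_word_Cons to_row_def zip_replicate2)

lemma tab_word_C_proper_Cons:
  "tab_word (C_tab \<alpha> (length t # lam)) (proper_tab (t # T)) =
    from_row (\<alpha> 0) t @ tab_word (C_tab (\<alpha> \<circ> Suc) lam) (proper_tab T)"
  by (simp add: C_tab_Cons tab_word_Cons from_row_def proper_tab_def zip_replicate1)

lemma tab_word_D_proper_Cons:
  "tab_word (D_tab \<beta> (length t # lam)) (proper_tab (t # T)) =
    pair_row (map \<beta> [0..<length t]) t @ tab_word (D_tab \<beta> lam) (proper_tab T)"
  by (simp add: D_tab_Cons tab_word_Cons pair_row_def proper_tab_def comp_def)

lemma mult_of_int_left: "(x :: 'a::ring_1) * (of_int a * y) = of_int a * (x * y)"
  by (metis mult.assoc mult_of_int_commute)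

text \<open>A pair lies within one of two blocks or meets both. The mixed term \<open>m * n\<close>
  is the exponent of interchanging two blocks of odd factors.\<close>

lemma choose_two_add: "(m + n) choose 2 = (m choose 2) + (n choose 2) + m * n"
proof (induct m)
  case (Suc m)
  have "Suc k choose 2 = (k choose 2) + k" for k
    by (simp add: numeral_2_eq_2)
  then show ?case using Suc by simp
qed simp

lemma set_tab_word: "set (tab_word S T) \<subseteq> \<Union> (set ` set S) \<times> \<Union> (set ` set T)"
  unfolding tab_word_def by (auto dest: set_zip_leftD set_zip_rightD)

text \<open>The lower rows stand rightmost and are rewritten first, by the induction hypothesis. The
  result has only negative symbols as first entries and so can be the context \<open>zs\<close> when
  \<open>polarize_row\<close> treats the first row.\<close>

lemma polarize_tab:
  fixes \<alpha> :: "nat \<Rightarrow> 'p" and \<beta> :: "nat \<Rightarrow> 'q" and T :: "'n list list"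
  assumes "shape T = lam" "inj_on \<alpha> {..<length lam}"
  shows "irr_eq (e_tab (D_tab \<beta> lam) (C_tab \<alpha> lam) * e_tab (C_tab \<alpha> lam) (proper_tab T))
    ((- 1) ^ (sum_list lam choose 2) *
      (\<Sum>\<sigma>\<in>row_perms lam. of_int (row_sign lam \<sigma>) *
        (e_tab (D_tab \<beta> lam) (proper_tab (permute_rows \<sigma> T)) :: ('p, 'q, 'n) env)))"
  using assms
proof (induct T arbitrary: lam \<alpha>)
  case Nil
  then have "lam = []" by (simp add: shape_def)
  then show ?case
    by (simp add: row_perms_def row_sign_def permute_rows_def proper_tab_def D_tab_def C_tab_def
        e_tab_def irr_eq_refl numeral_2_eq_2)
next
  case (Cons t T)
  let ?lam = "shape T" and ?k = "length t" and ?a = "\<alpha> \<circ> Suc"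
  have lam: "lam = ?k # ?lam" using Cons.prems(1) by (simp add: shape_def)
  have inj: "inj_on ?a {..<length ?lam}" "\<And>r. r < length ?lam \<Longrightarrow> \<alpha> 0 \<noteq> \<alpha> (Suc r)"
    using Cons.prems(2) by (auto simp: lam inj_on_def)
  let ?ds = "map \<beta> [0..<?k]"
  let ?Xr = "to_row ?ds (\<alpha> 0) :: ('p, 'q, 'n) letter list"
  let ?Yr = "from_row (\<alpha> 0) t :: ('p, 'q, 'n) letter list"
  let ?X = "tab_word (D_tab \<beta> ?lam) (C_tab ?a ?lam) :: ('p, 'q, 'n) letter list"
  let ?Y = "tab_word (C_tab ?a ?lam) (proper_tab T) :: ('p, 'q, 'n) letter list"
  let ?Z = "\<lambda>\<sigma>. tab_word (D_tab \<beta> ?lam) (proper_tab (permute_rows \<sigma> T)) :: ('p, 'q, 'n) letter list"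
  let ?h = "sum_list ?lam"
  have X: "tab_word (D_tab \<beta> lam) (C_tab \<alpha> lam) = ?Xr @ ?X"
    unfolding lam by (rule tab_word_D_C_Cons)
  have Y: "tab_word (C_tab \<alpha> lam) (proper_tab (t # T)) = ?Yr @ ?Y"
    unfolding lam by (rule tab_word_C_proper_Cons)
  have Z: "tab_word (D_tab \<beta> lam) (proper_tab (permute_rows \<sigma> (t # T))) =
      pair_row ?ds (permute_list (\<sigma> 0) t) @ ?Z (\<sigma> \<circ> Suc)" for \<sigma>
    unfolding lam permute_rows_Cons
    using tab_word_D_proper_Cons [of \<beta> "permute_list (\<sigma> 0) t"] by simp
  have setX: "fst x \<in> range Neg \<and> snd x \<in> (\<lambda>r. Pos (\<alpha> (Suc r))) ` {..<length ?lam}" if "x \<in> set ?X" for x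
    using that subsetD [OF set_tab_word that] by (auto simp: D_tab_def C_tab_def)
  have "sum_list (map letter_degree ?X) = length ?X"
  proof -
    have "map letter_degree ?X = map (\<lambda>_. 1) ?X"
      by (rule map_cong) (auto dest!: setX)
    then show ?thesis by (simp only: map_replicate_const sum_list_replicate) simp
  qed
  then have degX: "sum_list (map letter_degree ?X) = ?h"
    by (simp add: tab_word_def length_concat_shape shape_D_tab shape_C_tab)
  have "e_tab (D_tab \<beta> lam) (C_tab \<alpha> lam) * e_tab (C_tab \<alpha> lam) (proper_tab (t # T)) =
      e_prod (?Xr @ ?X @ ?Yr @ ?Y)"
    by (simp add: e_tab_eq X Y e_prod_append mult.assoc)
  \<comment> \<open>Different rows carry different \<open>\<alpha>\<close>, so the two blocks
    supercommute without bracket terms.\<close>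
  also have "\<dots> = (- 1) ^ (?h * ?k) * e_prod (?Xr @ ?Yr @ ?X @ ?Y)"
  proof -
    have "e_prod (?Xr @ ?X @ ?Yr @ ?Y) = (- 1) ^ (sum_list (map letter_degree ?X) *
        sum_list (map letter_degree ?Yr)) * e_prod (?Xr @ ?Yr @ ?X @ ?Y)"
      using inj(2) by (intro e_prod_commute_words) (force dest!: setX simp: from_row_def)
    then show ?thesis by (simp only: degX degree_from_row)
  qed
  also have "\<dots> = ((- 1) ^ (?h * ?k) * e_prod (?Xr @ ?Yr)) * (e_prod ?X * e_prod ?Y)"
    by (simp add: e_prod_append mult.assoc)
  also have "irr_eq \<dots> (((- 1) ^ (?h * ?k) * e_prod (?Xr @ ?Yr)) * ((- 1) ^ (?h choose 2) *
      (\<Sum>\<sigma>\<in>row_perms ?lam. of_int (row_sign ?lam \<sigma>) * e_prod (?Z \<sigma>))))"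
    using Cons.hyps [OF refl inj(1)] by (intro irr_eq_mult) (simp only: e_tab_eq)
  also have "\<dots> = (\<Sum>\<sigma>\<in>row_perms ?lam. of_int ((- 1) ^ (?h * ?k) * (- 1) ^ (?h choose 2) * row_sign ?lam \<sigma>) *
      e_prod (?Xr @ ?Yr @ ?Z \<sigma>))"
  proof -
    have "((- 1) ^ (?h * ?k) * e_prod (?Xr @ ?Yr)) * ((- 1) ^ (?h choose 2) * (of_int c * y)) =
        of_int ((- 1) ^ (?h * ?k) * (- 1) ^ (?h choose 2) * c) * (e_prod (?Xr @ ?Yr) * y)" for c y
      using mult_of_int_left [of "e_prod (?Xr @ ?Yr)" "(- 1) ^ (?h choose 2)" "of_int c * y"]
        mult_of_int_left [of "e_prod (?Xr @ ?Yr)" c y]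
      by (simp add: mult.assoc)
    moreover have "e_prod (?Xr @ ?Yr @ ?Z \<sigma>) = e_prod (?Xr @ ?Yr) * e_prod (?Z \<sigma>)" for \<sigma>
      by (simp add: e_prod_append mult.assoc)
    ultimately show ?thesis by (simp only: sum_distrib_left)
  qed
  also have "irr_eq \<dots> (\<Sum>\<sigma>\<in>row_perms ?lam. of_int ((- 1) ^ (?h * ?k) * (- 1) ^ (?h choose 2) * row_sign ?lam \<sigma>) *
      ((- 1) ^ (length ?ds choose 2) * (\<Sum>p | p permutes {..<length ?ds}. of_int (sign p) *
        e_prod (pair_row ?ds (permute_list p t) @ ?Z \<sigma>))))"
  proof (intro irr_eq_sum irr_eq_mult polarize_row)
    show "Pos (\<alpha> 0) \<notin> fst ` set (?Z \<sigma>)" for \<sigma>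
      using set_tab_word [of "D_tab \<beta> ?lam" "proper_tab (permute_rows \<sigma> T)"] by (force simp: D_tab_def)
  qed simp
  also have "\<dots> = (\<Sum>\<sigma>\<in>row_perms ?lam. \<Sum>p | p permutes {..<?k}. (- 1) ^ ((?k + ?h) choose 2) *
      (of_int (sign p * row_sign ?lam \<sigma>) * e_prod (pair_row ?ds (permute_list p t) @ ?Z \<sigma>)))"
  proof -
    \<comment> \<open>Signs are collected in \<open>int\<close>, where \<open>ac_simps\<close>
      applies; \<open>env\<close> is not commutative.\<close>
    let ?A = "(- 1) ^ (?h * ?k) :: int" and ?B = "(- 1) ^ (?h choose 2) :: int"
      and ?C = "(- 1) ^ (length ?ds choose 2) :: int"
    have "(- 1) ^ ((?k + ?h) choose 2) = ?C * ?B * ?A"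
      by (simp add: choose_two_add power_add mult.commute)
    then have "(of_int ((- 1) ^ ((?k + ?h) choose 2)) :: ('p, 'q, 'n) env) = of_int (?C * ?B * ?A)"
      by (simp only:)
    then have sign: "((- 1) ^ ((?k + ?h) choose 2) :: ('p, 'q, 'n) env) = of_int (?C * ?B * ?A)"
      by (simp only: of_int_power of_int_minus of_int_1)
    have "of_int (?A * ?B * r) * ((- 1) ^ (length ?ds choose 2) * (of_int s * x)) =
        (- 1) ^ ((?k + ?h) choose 2) * (of_int (s * r) * x)" for r s and x :: "('p, 'q, 'n) env"
    proof -
      have "of_int (?A * ?B * r) * (of_int ?C * (of_int s * x)) = of_int (?C * ?B * ?A) * (of_int (s * r) * x)"
        by (simp only: mult.assoc [symmetric] of_int_mult [symmetric]) (simp only: ac_simps)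
      then show ?thesis unfolding sign by (simp only: of_int_power of_int_minus of_int_1)
    qed
    then show ?thesis by (simp only: sum_distrib_left length_map length_upt diff_zero)
  qed
  also have "\<dots> = (\<Sum>\<sigma>\<in>row_perms lam. (- 1) ^ (sum_list lam choose 2) *
      (of_int (row_sign lam \<sigma>) * e_tab (D_tab \<beta> lam) (proper_tab (permute_rows \<sigma> (t # T)))))"
    unfolding e_tab_eq Z unfolding lam row_sign_Cons sum_list.Cons
    by (rule sum_row_perms_Cons [where f = "\<lambda>p \<sigma>. (- 1) ^ ((?k + ?h) choose 2) *
      (of_int (sign p * row_sign ?lam \<sigma>) * e_prod (pair_row ?ds (permute_list p t) @ ?Z \<sigma>))",
      symmetric])
  finally show ?case by (simp only: sum_distrib_left)
qed


section \<open>Capelli bitableaux\<close>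

text \<open>The order of quantifiers matters: one \<open>u\<close> serves all virtual choices. The
  row and column indices themselves act as virtual symbols, and every choice is an injective
  relabelling of that word.\<close>

lemma young_capelli_word:
  fixes S T :: "'n list list"
  assumes "shape S = lam" "shape T = lam"
  shows "\<exists>u\<in>U_gl. \<forall>\<alpha> \<beta>. virtual_choice \<alpha> \<beta> lam \<longrightarrow>
    irr_eq (e_tab (proper_tab S) (C_tab \<alpha> lam) * e_tab (C_tab \<alpha> lam) (D_tab \<beta> lam) *
      e_tab (D_tab \<beta> lam) (proper_tab T)) (u :: ('p, 'q, 'n) env)"
proof -
  let ?S = "proper_tab S :: (nat, nat, 'n) symbol list list"
  let ?T = "proper_tab T :: (nat, nat, 'n) symbol list list"
  let ?C = "C_tab id lam :: (nat, nat, 'n) symbol list list"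
  let ?D = "D_tab id lam :: (nat, nat, 'n) symbol list list"
  let ?w = "tab_word ?S ?C @ tab_word ?C ?D @ tab_word ?D ?T"
  have len: "length (concat ?S) = sum_list lam" "length (concat ?T) = sum_list lam"
    "length (concat ?C) = sum_list lam" "length (concat ?D) = sum_list lam"
    by (simp_all only: length_concat_shape shape_proper_tab shape_C_tab shape_D_tab assms)
  have "count_list (concat (proper_tab R)) \<gamma> = 0" if "\<gamma> \<in> virtual"
    for R :: "'n list list" and \<gamma> :: "(nat, nat, 'n) symbol"
    using that by (auto simp: count_list_0_iff proper_tab_def virtual_def)
  then have "balanced ?w"
    by (simp add: balanced_def weight_def tab_word_def len)
  then obtain u where u: "u \<in> U_gl" "\<And>\<alpha> \<beta>. inj_on (map_symbol \<alpha> \<beta> id) (symbols ?w) \<Longrightarrow>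
      (e_prod (map (relabel \<alpha> \<beta>) ?w) :: ('p, 'q, 'n) env) - u \<in> Irr"
    using balanced_devirt by blast
  have "irr_eq (e_tab (proper_tab S) (C_tab \<alpha> lam) * e_tab (C_tab \<alpha> lam) (D_tab \<beta> lam) *
      e_tab (D_tab \<beta> lam) (proper_tab T)) u" if vc: "virtual_choice \<alpha> \<beta> lam" for \<alpha> \<beta>
  proof -
    let ?m = "map_symbol \<alpha> \<beta> id"
    have word: "map (relabel \<alpha> \<beta>) (tab_word A B) = tab_word (map (map ?m) A) (map (map ?m) B)"
      for A B :: "(nat, nat, 'n) symbol list list"
      by (simp add: tab_word_def map_concat [symmetric] zip_map_map) (auto intro: map_cong)
    have tabs: "map (map ?m) (proper_tab R) = proper_tab R" for R :: "'n list list"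
      by (simp add: proper_tab_def comp_def)
    have "map (map ?m) ?C = C_tab \<alpha> lam" "map (map ?m) ?D = D_tab \<beta> lam"
      by (simp_all add: C_tab_def D_tab_def comp_def)
    then have "e_prod (map (relabel \<alpha> \<beta>) ?w) = e_tab (proper_tab S) (C_tab \<alpha> lam) *
        e_tab (C_tab \<alpha> lam) (D_tab \<beta> lam) * e_tab (D_tab \<beta> lam) (proper_tab T)"
      by (simp add: word tabs e_prod_append e_tab_eq mult.assoc)
    moreover have "inj_on ?m (symbols ?w)"
    proof (rule inj_on_subset)
      let ?P = "Pos ` {..<length lam} \<union> Neg ` (\<Union>k\<in>set lam. {..<k}) \<union> range Proper
        :: (nat, nat, 'n) symbol set"
      \<comment> \<open>\<open>\<beta>\<close> is known to be injective on single rows only; the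
        longer of two rows contains both columns.\<close>
      have "c = c'" if "k \<in> set lam" "k' \<in> set lam" "c < k" "c' < k'" "\<beta> c = \<beta> c'" for k k' c c'
      proof -
        have "max k k' \<in> set lam" using that by (simp add: max_def)
        then have "inj_on \<beta> {..<max k k'}" using vc by (simp add: virtual_choice_def)
        then show ?thesis using that by (auto dest: inj_onD)
      qed
      then show "inj_on ?m ?P"
        using vc by (auto simp: inj_on_def virtual_choice_def)
      have zip: "set (zip xs ys) \<subseteq> ?P \<times> ?P" if "set xs \<subseteq> ?P" "set ys \<subseteq> ?P" for xs ys
        by (intro subrelI SigmaI)
          (erule subsetD [OF that(1) set_zip_leftD], erule subsetD [OF that(2) set_zip_rightD])
      have "set (concat ?S) \<subseteq> ?P" "set (concat ?T) \<subseteq> ?P" "set (concat ?C) \<subseteq> ?P" "set (concat ?D) \<subseteq> ?P"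
        by (force simp: proper_tab_def C_tab_def D_tab_def)+
      then have "set (tab_word ?S ?C) \<subseteq> ?P \<times> ?P" "set (tab_word ?C ?D) \<subseteq> ?P \<times> ?P"
        "set (tab_word ?D ?T) \<subseteq> ?P \<times> ?P"
        unfolding tab_word_def by (intro zip; simp only:)+
      then show "symbols ?w \<subseteq> ?P"
        by (intro symbols_subset) (simp only: set_append Un_least)
    qed
    ultimately show ?thesis using u(2) [of \<alpha> \<beta>] by (simp add: irr_eq_def)
  qed
  then show ?thesis using u(1) by blast
qed

theorem proposition2p14:
  fixes lam :: "nat list" and h :: nat
    and S T :: "'n::finite list list"
    and \<alpha> \<alpha>' :: "nat \<Rightarrow> 'p::finite" and \<beta> \<beta>' :: "nat \<Rightarrow> 'q::finite"
  assumes "partition_of lam h"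
    and "shape S = lam" and "shape T = lam"
    and "virtual_choice \<alpha> \<beta> lam" and "virtual_choice \<alpha>' \<beta>' lam"
  shows "double_young_capelli \<alpha> \<beta> S T =
    (- 1) ^ (h choose 2) *
    (\<Sum>\<sigma>\<in>row_perms lam. of_int (row_sign lam \<sigma>) * young_capelli \<alpha>' \<beta>' S (permute_rows \<sigma> T))"
proof -
  let ?C = "C_tab \<alpha> lam :: ('p, 'q, 'n) symbol list list"
  let ?D = "D_tab \<beta> lam :: ('p, 'q, 'n) symbol list list"
  let ?L = "e_tab (proper_tab S) ?C * e_tab ?C ?D"
  have h: "sum_list lam = h" using assms(1) by (simp add: partition_of_def)
  \<comment> \<open>The same \<open>u\<close> is applied below to \<open>\<alpha>, \<beta>\<close>
    on the left and to \<open>\<alpha>', \<beta>'\<close> on the right of the identity.\<close>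
  have "\<exists>u\<in>U_gl. \<forall>\<alpha> \<beta>. virtual_choice \<alpha> \<beta> lam \<longrightarrow>
    irr_eq (e_tab (proper_tab S) (C_tab \<alpha> lam) * e_tab (C_tab \<alpha> lam) (D_tab \<beta> lam) *
      e_tab (D_tab \<beta> lam) (proper_tab (permute_rows \<sigma> T))) (u :: ('p, 'q, 'n) env)" for \<sigma>
    using assms by (intro young_capelli_word) (simp_all add: shape_permute_rows)
  then obtain u where u: "u \<sigma> \<in> U_gl" "\<And>\<alpha> \<beta>. virtual_choice \<alpha> \<beta> lam \<Longrightarrow>
    irr_eq (e_tab (proper_tab S) (C_tab \<alpha> lam) * e_tab (C_tab \<alpha> lam) (D_tab \<beta> lam) *
      e_tab (D_tab \<beta> lam) (proper_tab (permute_rows \<sigma> T))) (u \<sigma> :: ('p, 'q, 'n) env)" for \<sigma>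
    by metis
  have yc: "young_capelli \<alpha>' \<beta>' S (permute_rows \<sigma> T) = u \<sigma>" for \<sigma>
    unfolding young_capelli_def Let_def assms(2)
    using u(2) [OF assms(5)] by (intro devirt_eqI u(1)) (simp add: irr_eq_def)
  let ?v = "(- 1) ^ (h choose 2) * (\<Sum>\<sigma>\<in>row_perms lam. of_int (row_sign lam \<sigma>) * u \<sigma>)"
  have "irr_eq (?L * (e_tab ?D ?C * e_tab ?C (proper_tab T)))
      (?L * ((- 1) ^ (h choose 2) * (\<Sum>\<sigma>\<in>row_perms lam. of_int (row_sign lam \<sigma>) *
        e_tab ?D (proper_tab (permute_rows \<sigma> T)))))"
    using polarize_tab [OF assms(3), of \<alpha> \<beta>] assms(4)
    by (intro irr_eq_mult) (simp add: virtual_choice_def h)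
  also have "\<dots> = (- 1) ^ (h choose 2) * (\<Sum>\<sigma>\<in>row_perms lam. of_int (row_sign lam \<sigma>) *
        (?L * e_tab ?D (proper_tab (permute_rows \<sigma> T))))"
  proof -
    have "?L * ((- 1) ^ (h choose 2) * (of_int a * y)) = (- 1) ^ (h choose 2) * (of_int a * (?L * y))"
      for a y
      using mult_of_int_left [of ?L "(- 1) ^ (h choose 2)" "of_int a * y"] mult_of_int_left [of ?L a y]
      by simp
    then show ?thesis by (simp only: sum_distrib_left)
  qed
  also have "irr_eq \<dots> ?v"
    by (intro irr_eq_mult irr_eq_sum u(2) assms(4))
  finally have "?L * (e_tab ?D ?C * e_tab ?C (proper_tab T)) - ?v \<in> Irr"
    by (simp only: irr_eq_def)
  moreover have "of_int ((- 1) ^ (h choose 2)) *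
      (\<Sum>\<sigma>\<in>row_perms lam. of_int (row_sign lam \<sigma>) * u \<sigma>) \<in> U_gl"
    by (intro U_gl_mult U_gl_of_int U_gl_sum u(1))
  then have "?v \<in> U_gl" by simp
  ultimately have "devirt (?L * (e_tab ?D ?C * e_tab ?C (proper_tab T))) = ?v"
    by (intro devirt_eqI)
  then show ?thesis
    by (simp add: double_young_capelli_def Let_def assms(2) yc mult.assoc)
qed

end
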